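(* Let $k$ be a field, $\lambda\in k$, $(C,P)$ a Rota-Baxter coalgebra of weight $\lambda$ with comultiplication $\Delta$, and $(M,P,T)$ a Rota-Baxter paired $C$-comodule of weight $\lambda$ with coaction $\rho$. Define another comultiplication on $C$ by $$\Delta'=(\mathrm{id}\otimes P)\Delta+(P\otimes\mathrm{id})\Delta+\lambda\Delta,$$ and a map $\rho':M\to C\otimes M$ by $$\rho'=(P\otimes\mathrm{id})\rho+(\mathrm{id}\otimes T)\rho+\lambda\rho.$$ Then the following hold. (a) $(C,\Delta',P)$ is also a (noncounitary) Rota-Baxter coalgebra of weight $\lambda$. (b) $\rho'T=(P\otimes T)\rho$. (c) $(M,\rho')$ is a noncounitary $(C,\Delta')$-comodule. (d) $(M,P,T)$ is a Rota-Baxter paired $(C,\Delta')$-comodule of weight $\lambda$, whose comodule structure map is given by $\rho'$.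
   Context: All spaces, maps and tensor products are over $k$. A coalgebra $(C,\Delta)$ with a linear map $P:C\to C$ is a Rota-Baxter coalgebra of weight $\lambda$ if $(P\otimes P)\Delta=(P\otimes \mathrm{id})\Delta P+(\mathrm{id}\otimes P)\Delta P+\lambda\Delta P$. For a left $C$-comodule $M$ with coaction $\rho:M\to C\otimes M$ and linear maps $P:C\to C$, $T:M\to M$, $(M,P,T)$ is a Rota-Baxter paired (left) $C$-comodule of weight $\lambda$ if $(P\otimes T)\rho=(P\otimes \mathrm{id})\rho T+(\mathrm{id}\otimes T)\rho T+\lambda\rho T$. "Noncounitary" means that no counit is required: a noncounitary coalgebra is a space with a coassociative comultiplication, and a noncounitary left comodule over $(C,\Delta')$ is a space $M$ with a linear map $\rho':M\to C\otimes M$ satisfying $(\mathrm{id}\otimes\rho')\rho'=(\Delta'\otimes\mathrm{id})\rho'$. The Rota-Baxter notions for $(C,\Delta')$ and $(M,\rho')$ are defined by the same identities with $\Delta',\rho'$ in place of $\Delta,\rho$. *)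

theory Defs
  imports "HOL-Algebra.Module" "HOL-Algebra.AbelCoset"
begin

section \<open>Tensor products of modules\<close>

text \<open>The ring components \<open>mult\<close> and \<open>one\<close> that every module record inherits play no role
  in the locale \<open>module\<close>; they are left undefined in the free and quotient modules below.\<close>

definition linear_maps ::
  "('k, 'm) ring_scheme \<Rightarrow> ('k, 'a, 'p) module_scheme \<Rightarrow> ('k, 'b, 'q) module_scheme \<Rightarrow> ('a \<Rightarrow> 'b) set"
  where "linear_maps K V W = {f. f \<in> carrier V \<rightarrow> carrier W
      \<and> (\<forall>x\<in>carrier V. \<forall>y\<in>carrier V. f (x \<oplus>\<^bsub>V\<^esub> y) = f x \<oplus>\<^bsub>W\<^esub> f y)
      \<and> (\<forall>r\<in>carrier K. \<forall>x\<in>carrier V. f (r \<odot>\<^bsub>V\<^esub> x) = r \<odot>\<^bsub>W\<^esub> f x)}"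

definition bilinear_maps ::
  "('k, 'm) ring_scheme \<Rightarrow> ('k, 'a, 'p) module_scheme \<Rightarrow> ('k, 'b, 'q) module_scheme
    \<Rightarrow> ('k, 'c, 'r) module_scheme \<Rightarrow> ('a \<Rightarrow> 'b \<Rightarrow> 'c) set"
  where "bilinear_maps K A B W = {\<beta>.
      (\<forall>b\<in>carrier B. (\<lambda>a. \<beta> a b) \<in> linear_maps K A W)
      \<and> (\<forall>a\<in>carrier A. \<beta> a \<in> linear_maps K B W)}"

text \<open>The base ring as a module over itself.\<close>

definition scalar_module :: "('k, 'm) ring_scheme \<Rightarrow> ('k, 'k) module"
  where "scalar_module K = \<lparr>carrier = carrier K, mult = mult K, one = one K,
      zero = zero K, add = add K, smult = mult K\<rparr>"

definition fsupp :: "('k, 'm) ring_scheme \<Rightarrow> ('s \<Rightarrow> 'k) \<Rightarrow> 's set"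
  where "fsupp K x = {p. x p \<noteq> \<zero>\<^bsub>K\<^esub>}"

definition free_module :: "('k, 'm) ring_scheme \<Rightarrow> 's set \<Rightarrow> ('k, 's \<Rightarrow> 'k) module"
  where "free_module K S = \<lparr>
      carrier = {x. range x \<subseteq> carrier K \<and> fsupp K x \<subseteq> S \<and> finite (fsupp K x)},
      mult = undefined, one = undefined,
      zero = (\<lambda>p. \<zero>\<^bsub>K\<^esub>), add = (\<lambda>x y p. x p \<oplus>\<^bsub>K\<^esub> y p),
      smult = (\<lambda>r x p. r \<otimes>\<^bsub>K\<^esub> x p)\<rparr>"

definition basis_vec :: "('k, 'm) ring_scheme \<Rightarrow> 's \<Rightarrow> 's \<Rightarrow> 'k"
  where "basis_vec K p = (\<lambda>q. if q = p then \<one>\<^bsub>K\<^esub> else \<zero>\<^bsub>K\<^esub>)"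

definition quot_module ::
  "('k, 'm) ring_scheme \<Rightarrow> ('k, 'a, 'p) module_scheme \<Rightarrow> 'a set \<Rightarrow> ('k, 'a set) module"
  where "quot_module K F N = \<lparr>
      carrier = a_rcosets\<^bsub>F\<^esub> N, mult = undefined, one = undefined,
      zero = N, add = set_add F,
      smult = (\<lambda>r X. \<Union>x\<in>X. N +>\<^bsub>F\<^esub> (r \<odot>\<^bsub>F\<^esub> x))\<rparr>"

text \<open>The tensor product is the usual quotient of the free module on pairs by the submodule
  generated by the bilinearity relations.\<close>

abbreviation pair_module ::
  "('k, 'm) ring_scheme \<Rightarrow> ('k, 'a, 'p) module_scheme \<Rightarrow> ('k, 'b, 'q) module_scheme
    \<Rightarrow> ('k, 'a \<times> 'b \<Rightarrow> 'k) module"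
  where "pair_module K A B \<equiv> free_module K (carrier A \<times> carrier B)"

inductive_set tensor_gens ::
  "('k, 'm) ring_scheme \<Rightarrow> ('k, 'a, 'p) module_scheme \<Rightarrow> ('k, 'b, 'q) module_scheme
    \<Rightarrow> ('a \<times> 'b \<Rightarrow> 'k) set" for K A B
  where
    add_left: "\<lbrakk>a \<in> carrier A; a' \<in> carrier A; b \<in> carrier B\<rbrakk> \<Longrightarrow>
      basis_vec K (a \<oplus>\<^bsub>A\<^esub> a', b)
        \<ominus>\<^bsub>pair_module K A B\<^esub> (basis_vec K (a, b) \<oplus>\<^bsub>pair_module K A B\<^esub> basis_vec K (a', b))
      \<in> tensor_gens K A B"
  | add_right: "\<lbrakk>a \<in> carrier A; b \<in> carrier B; b' \<in> carrier B\<rbrakk> \<Longrightarrow>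
      basis_vec K (a, b \<oplus>\<^bsub>B\<^esub> b')
        \<ominus>\<^bsub>pair_module K A B\<^esub> (basis_vec K (a, b) \<oplus>\<^bsub>pair_module K A B\<^esub> basis_vec K (a, b'))
      \<in> tensor_gens K A B"
  | smult_left: "\<lbrakk>r \<in> carrier K; a \<in> carrier A; b \<in> carrier B\<rbrakk> \<Longrightarrow>
      basis_vec K (r \<odot>\<^bsub>A\<^esub> a, b)
        \<ominus>\<^bsub>pair_module K A B\<^esub> (r \<odot>\<^bsub>pair_module K A B\<^esub> basis_vec K (a, b))
      \<in> tensor_gens K A B"
  | smult_right: "\<lbrakk>r \<in> carrier K; a \<in> carrier A; b \<in> carrier B\<rbrakk> \<Longrightarrow>
      basis_vec K (a, r \<odot>\<^bsub>B\<^esub> b)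
        \<ominus>\<^bsub>pair_module K A B\<^esub> (r \<odot>\<^bsub>pair_module K A B\<^esub> basis_vec K (a, b))
      \<in> tensor_gens K A B"

definition tensor_rel ::
  "('k, 'm) ring_scheme \<Rightarrow> ('k, 'a, 'p) module_scheme \<Rightarrow> ('k, 'b, 'q) module_scheme
    \<Rightarrow> ('a \<times> 'b \<Rightarrow> 'k) set"
  where "tensor_rel K A B =
      \<Inter>{N. submodule N K (pair_module K A B) \<and> tensor_gens K A B \<subseteq> N}"

definition tensor ::
  "('k, 'm) ring_scheme \<Rightarrow> ('k, 'a, 'p) module_scheme \<Rightarrow> ('k, 'b, 'q) module_scheme
    \<Rightarrow> ('k, ('a \<times> 'b \<Rightarrow> 'k) set) module"
  where "tensor K A B = quot_module K (pair_module K A B) (tensor_rel K A B)"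

definition pure_tensor ::
  "('k, 'm) ring_scheme \<Rightarrow> ('k, 'a, 'p) module_scheme \<Rightarrow> ('k, 'b, 'q) module_scheme
    \<Rightarrow> 'a \<Rightarrow> 'b \<Rightarrow> ('a \<times> 'b \<Rightarrow> 'k) set"
  where "pure_tensor K A B a b = tensor_rel K A B +>\<^bsub>pair_module K A B\<^esub> basis_vec K (a, b)"

lemma linear_mapsD:
  assumes "f \<in> linear_maps K V W"
  shows "x \<in> carrier V \<Longrightarrow> f x \<in> carrier W"
    and "x \<in> carrier V \<Longrightarrow> y \<in> carrier V \<Longrightarrow> f (x \<oplus>\<^bsub>V\<^esub> y) = f x \<oplus>\<^bsub>W\<^esub> f y"
    and "r \<in> carrier K \<Longrightarrow> x \<in> carrier V \<Longrightarrow> f (r \<odot>\<^bsub>V\<^esub> x) = r \<odot>\<^bsub>W\<^esub> f x"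
  using assms by (auto simp: linear_maps_def)

lemma bilinear_mapsD:
  assumes "\<beta> \<in> bilinear_maps K A B W"
  shows "a \<in> carrier A \<Longrightarrow> b \<in> carrier B \<Longrightarrow> \<beta> a b \<in> carrier W"
    and "a \<in> carrier A \<Longrightarrow> a' \<in> carrier A \<Longrightarrow> b \<in> carrier B \<Longrightarrow>
      \<beta> (a \<oplus>\<^bsub>A\<^esub> a') b = \<beta> a b \<oplus>\<^bsub>W\<^esub> \<beta> a' b"
    and "a \<in> carrier A \<Longrightarrow> b \<in> carrier B \<Longrightarrow> b' \<in> carrier B \<Longrightarrow>
      \<beta> a (b \<oplus>\<^bsub>B\<^esub> b') = \<beta> a b \<oplus>\<^bsub>W\<^esub> \<beta> a b'"
    and "r \<in> carrier K \<Longrightarrow> a \<in> carrier A \<Longrightarrow> b \<in> carrier B \<Longrightarrow> \<beta> (r \<odot>\<^bsub>A\<^esub> a) b = r \<odot>\<^bsub>W\<^esub> \<beta> a b"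
    and "r \<in> carrier K \<Longrightarrow> a \<in> carrier A \<Longrightarrow> b \<in> carrier B \<Longrightarrow> \<beta> a (r \<odot>\<^bsub>B\<^esub> b) = r \<odot>\<^bsub>W\<^esub> \<beta> a b"
proof -
  have l: "(\<lambda>a. \<beta> a b) \<in> linear_maps K A W" if "b \<in> carrier B" for b
    using assms that by (simp add: bilinear_maps_def)
  have r: "\<beta> a \<in> linear_maps K B W" if "a \<in> carrier A" for a
    using assms that by (simp add: bilinear_maps_def)
  show "a \<in> carrier A \<Longrightarrow> b \<in> carrier B \<Longrightarrow> \<beta> a b \<in> carrier W"
    by (rule linear_mapsD(1)[OF r])
  show "a \<in> carrier A \<Longrightarrow> a' \<in> carrier A \<Longrightarrow> b \<in> carrier B \<Longrightarrow>
      \<beta> (a \<oplus>\<^bsub>A\<^esub> a') b = \<beta> a b \<oplus>\<^bsub>W\<^esub> \<beta> a' b"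
    by (rule linear_mapsD(2)[OF l])
  show "a \<in> carrier A \<Longrightarrow> b \<in> carrier B \<Longrightarrow> b' \<in> carrier B \<Longrightarrow>
      \<beta> a (b \<oplus>\<^bsub>B\<^esub> b') = \<beta> a b \<oplus>\<^bsub>W\<^esub> \<beta> a b'"
    by (rule linear_mapsD(2)[OF r])
  show "r \<in> carrier K \<Longrightarrow> a \<in> carrier A \<Longrightarrow> b \<in> carrier B \<Longrightarrow> \<beta> (r \<odot>\<^bsub>A\<^esub> a) b = r \<odot>\<^bsub>W\<^esub> \<beta> a b"
    by (rule linear_mapsD(3)[OF l])
  show "r \<in> carrier K \<Longrightarrow> a \<in> carrier A \<Longrightarrow> b \<in> carrier B \<Longrightarrow> \<beta> a (r \<odot>\<^bsub>B\<^esub> b) = r \<odot>\<^bsub>W\<^esub> \<beta> a b"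
    by (rule linear_mapsD(3)[OF r])
qed

lemma linear_maps_zero:
  assumes "f \<in> linear_maps K V W" "module K V" "module K W"
  shows "f \<zero>\<^bsub>V\<^esub> = \<zero>\<^bsub>W\<^esub>"
proof -
  interpret V: module K V by fact
  interpret W: module K W by fact
  have "f (\<zero>\<^bsub>K\<^esub> \<odot>\<^bsub>V\<^esub> \<zero>\<^bsub>V\<^esub>) = \<zero>\<^bsub>K\<^esub> \<odot>\<^bsub>W\<^esub> f \<zero>\<^bsub>V\<^esub>"
    by (rule linear_mapsD(3)[OF assms(1)]) auto
  then show ?thesis
    using linear_mapsD(1)[OF assms(1), of "\<zero>\<^bsub>V\<^esub>"] by simp
qed

lemma linear_maps_minus:
  assumes f: "f \<in> linear_maps K V W" and V: "module K V" and W: "module K W"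
    and x: "x \<in> carrier V" and y: "y \<in> carrier V"
  shows "f (x \<ominus>\<^bsub>V\<^esub> y) = f x \<ominus>\<^bsub>W\<^esub> f y"
proof -
  interpret V: module K V by fact
  interpret W: module K W by fact
  note c = linear_mapsD(1)[OF f]
  have "f (x \<ominus>\<^bsub>V\<^esub> y) \<oplus>\<^bsub>W\<^esub> f y = f x"
    using linear_mapsD(2)[OF f, of "x \<ominus>\<^bsub>V\<^esub> y" y] x y
    by (simp add: V.M.minus_eq V.M.a_assoc V.M.l_neg)
  then have "f x \<ominus>\<^bsub>W\<^esub> f y = (f (x \<ominus>\<^bsub>V\<^esub> y) \<oplus>\<^bsub>W\<^esub> f y) \<ominus>\<^bsub>W\<^esub> f y" by simp
  also have "\<dots> = f (x \<ominus>\<^bsub>V\<^esub> y)"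
    using c x y by (simp add: W.M.minus_eq W.M.a_assoc W.M.r_neg)
  finally show ?thesis by simp
qed

lemma scalar_module_module:
  assumes "cring K" shows "module K (scalar_module K)"
proof -
  interpret cring K by fact
  show ?thesis
    by (intro moduleI abelian_groupI)
      (auto simp: scalar_module_def is_cring l_distr r_distr m_assoc a_ac intro: l_neg bexI[OF _ a_inv_closed])
qed

lemma free_module_simps [simp]:
  "x \<oplus>\<^bsub>free_module K S\<^esub> y = (\<lambda>p. x p \<oplus>\<^bsub>K\<^esub> y p)"
  "\<zero>\<^bsub>free_module K S\<^esub> = (\<lambda>p. \<zero>\<^bsub>K\<^esub>)"
  "r \<odot>\<^bsub>free_module K S\<^esub> x = (\<lambda>p. r \<otimes>\<^bsub>K\<^esub> x p)"
  by (simp_all add: free_module_def)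

lemma free_module_carrier:
  "x \<in> carrier (free_module K S) \<longleftrightarrow> (\<forall>p. x p \<in> carrier K) \<and> fsupp K x \<subseteq> S \<and> finite (fsupp K x)"
  by (auto simp: free_module_def)

lemma free_module_module:
  assumes "cring K" shows "module K (free_module K S)"
proof -
  interpret cring K by fact
  have add: "(\<lambda>p. x p \<oplus>\<^bsub>K\<^esub> y p) \<in> carrier (free_module K S)"
    if "x \<in> carrier (free_module K S)" "y \<in> carrier (free_module K S)" for x y
  proof -
    have "fsupp K (\<lambda>p. x p \<oplus>\<^bsub>K\<^esub> y p) \<subseteq> fsupp K x \<union> fsupp K y"
      by (auto simp: fsupp_def)
    with that show ?thesis
      by (auto simp: free_module_carrier intro: finite_subset)
  qed
  have smult: "(\<lambda>p. r \<otimes>\<^bsub>K\<^esub> x p) \<in> carrier (free_module K S)"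
    if "x \<in> carrier (free_module K S)" "r \<in> carrier K" for x r
  proof -
    have "fsupp K (\<lambda>p. r \<otimes>\<^bsub>K\<^esub> x p) \<subseteq> fsupp K x"
      using that by (auto simp: fsupp_def)
    with that show ?thesis
      by (auto simp: free_module_carrier intro: finite_subset)
  qed
  have inv: "(\<lambda>p. \<ominus>\<^bsub>K\<^esub> x p) \<in> carrier (free_module K S)"
    if "x \<in> carrier (free_module K S)" for x
  proof -
    have "fsupp K (\<lambda>p. \<ominus>\<^bsub>K\<^esub> x p) \<subseteq> fsupp K x"
      using that by (auto simp: fsupp_def)
    with that show ?thesis
      by (auto simp: free_module_carrier intro: finite_subset)
  qed
  show ?thesis
  proof (intro moduleI abelian_groupI)
    show "\<exists>y\<in>carrier (free_module K S). y \<oplus>\<^bsub>free_module K S\<^esub> x = \<zero>\<^bsub>free_module K S\<^esub>"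
      if "x \<in> carrier (free_module K S)" for x
      by (rule bexI[OF _ inv[OF that]]) (use that in \<open>auto simp: free_module_carrier l_neg\<close>)
  qed (use add smult in \<open>auto simp: is_cring free_module_carrier l_distr r_distr m_assoc a_assoc
        fsupp_def intro!: a_comm\<close>)
qed

lemma basis_vec_carrier:
  assumes "cring K" "p \<in> S" shows "basis_vec K p \<in> carrier (free_module K S)"
proof -
  interpret cring K by fact
  have "fsupp K (basis_vec K p) \<subseteq> {p}"
    by (auto simp: fsupp_def basis_vec_def)
  with assms(2) show ?thesis
    by (auto simp: free_module_carrier basis_vec_def intro: finite_subset)
qed

lemma quot_module_coset:
  assumes F: "module K F" and N: "submodule N K F"
  shows "x \<in> carrier F \<Longrightarrow> N +>\<^bsub>F\<^esub> x \<in> carrier (quot_module K F N)"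
    and "X \<in> carrier (quot_module K F N) \<Longrightarrow> \<exists>x\<in>carrier F. X = N +>\<^bsub>F\<^esub> x"
    and "x \<in> carrier F \<Longrightarrow> y \<in> carrier F \<Longrightarrow>
      (N +>\<^bsub>F\<^esub> x) \<oplus>\<^bsub>quot_module K F N\<^esub> (N +>\<^bsub>F\<^esub> y) = N +>\<^bsub>F\<^esub> (x \<oplus>\<^bsub>F\<^esub> y)"
    and "\<zero>\<^bsub>quot_module K F N\<^esub> = N +>\<^bsub>F\<^esub> \<zero>\<^bsub>F\<^esub>"
    and "x \<in> carrier F \<Longrightarrow> r \<in> carrier K \<Longrightarrow>
      r \<odot>\<^bsub>quot_module K F N\<^esub> (N +>\<^bsub>F\<^esub> x) = N +>\<^bsub>F\<^esub> (r \<odot>\<^bsub>F\<^esub> x)"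
    and "x \<in> carrier F \<Longrightarrow> y \<in> carrier F \<Longrightarrow>
      N +>\<^bsub>F\<^esub> x = N +>\<^bsub>F\<^esub> y \<longleftrightarrow> x \<ominus>\<^bsub>F\<^esub> y \<in> N"
proof -
  interpret F: module K F by fact
  interpret N: submodule N K F by fact
  have ab: "abelian_subgroup N F"
    by (intro abelian_subgroupI3 additive_subgroup.intro N.subgroup_axioms F.abelian_group_axioms)
  interpret N': abelian_subgroup N F by (rule ab)
  show 1: "x \<in> carrier F \<Longrightarrow> N +>\<^bsub>F\<^esub> x \<in> carrier (quot_module K F N)"
    by (simp add: quot_module_def F.a_rcosetsI N'.a_subset)
  show "X \<in> carrier (quot_module K F N) \<Longrightarrow> \<exists>x\<in>carrier F. X = N +>\<^bsub>F\<^esub> x"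
    by (auto simp: quot_module_def A_RCOSETS_def')
  show "x \<in> carrier F \<Longrightarrow> y \<in> carrier F \<Longrightarrow>
      (N +>\<^bsub>F\<^esub> x) \<oplus>\<^bsub>quot_module K F N\<^esub> (N +>\<^bsub>F\<^esub> y) = N +>\<^bsub>F\<^esub> (x \<oplus>\<^bsub>F\<^esub> y)"
    by (simp add: quot_module_def N'.a_rcos_sum)
  show "\<zero>\<^bsub>quot_module K F N\<^esub> = N +>\<^bsub>F\<^esub> \<zero>\<^bsub>F\<^esub>"
    by (simp add: quot_module_def N'.a_subset)
  have eq: "N +>\<^bsub>F\<^esub> x = N +>\<^bsub>F\<^esub> y" if x: "x \<in> carrier F" and y: "y \<in> N +>\<^bsub>F\<^esub> x" for x y
    by (rule F.a_repr_independence[OF y x]) (rule N.subgroup_axioms)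
  show "N +>\<^bsub>F\<^esub> x = N +>\<^bsub>F\<^esub> y \<longleftrightarrow> x \<ominus>\<^bsub>F\<^esub> y \<in> N"
    if x: "x \<in> carrier F" and y: "y \<in> carrier F"
  proof -
    have "N +>\<^bsub>F\<^esub> x = N +>\<^bsub>F\<^esub> y \<longleftrightarrow> x \<in> N +>\<^bsub>F\<^esub> y"
      using eq[OF y, of x] N'.a_rcos_self[OF x] by blast
    also have "\<dots> \<longleftrightarrow> x \<ominus>\<^bsub>F\<^esub> y \<in> N"
      unfolding F.M.minus_eq by (rule N'.a_rcos_module[OF y x])
    finally show ?thesis .
  qed
  show "r \<odot>\<^bsub>quot_module K F N\<^esub> (N +>\<^bsub>F\<^esub> x) = N +>\<^bsub>F\<^esub> (r \<odot>\<^bsub>F\<^esub> x)"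
    if x: "x \<in> carrier F" and r: "r \<in> carrier K"
  proof -
    have "N +>\<^bsub>F\<^esub> (r \<odot>\<^bsub>F\<^esub> y) = N +>\<^bsub>F\<^esub> (r \<odot>\<^bsub>F\<^esub> x)" if y: "y \<in> N +>\<^bsub>F\<^esub> x" for y
    proof -
      from y obtain n where n: "n \<in> N" "y = n \<oplus>\<^bsub>F\<^esub> x" by (auto simp: a_r_coset_def')
      then have "r \<odot>\<^bsub>F\<^esub> y = (r \<odot>\<^bsub>F\<^esub> n) \<oplus>\<^bsub>F\<^esub> (r \<odot>\<^bsub>F\<^esub> x)"
        using x r N'.a_subset by (auto simp: F.smult_r_distr)
      moreover have "r \<odot>\<^bsub>F\<^esub> n \<in> N" using n r by simp
      ultimately have "r \<odot>\<^bsub>F\<^esub> y \<in> N +>\<^bsub>F\<^esub> (r \<odot>\<^bsub>F\<^esub> x)"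
        by (auto simp: a_r_coset_def')
      then show ?thesis using eq[of "r \<odot>\<^bsub>F\<^esub> x" "r \<odot>\<^bsub>F\<^esub> y"] x r by simp
    qed
    moreover have "x \<in> N +>\<^bsub>F\<^esub> x" using x by (rule N'.a_rcos_self)
    ultimately have "(\<Union>y\<in>N +>\<^bsub>F\<^esub> x. N +>\<^bsub>F\<^esub> (r \<odot>\<^bsub>F\<^esub> y)) = N +>\<^bsub>F\<^esub> (r \<odot>\<^bsub>F\<^esub> x)"
      by blast
    then show ?thesis by (simp add: quot_module_def)
  qed
qed

lemma quot_module_module:
  assumes F: "module K F" and N: "submodule N K F"
  shows "module K (quot_module K F N)"
proof -
  interpret F: module K F by fact
  note q = quot_module_coset[OF F N]
  let ?Q = "quot_module K F N"
  have rep: "\<And>X. X \<in> carrier ?Q \<Longrightarrow> \<exists>x. x \<in> carrier F \<and> X = N +>\<^bsub>F\<^esub> x"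
    using q(2) by blast
  have add: "X \<oplus>\<^bsub>?Q\<^esub> Y \<in> carrier ?Q" if XY: "X \<in> carrier ?Q" "Y \<in> carrier ?Q" for X Y
    using rep[OF XY(1)] rep[OF XY(2)] by (auto simp: q(1,3))
  have zero: "\<zero>\<^bsub>?Q\<^esub> \<in> carrier ?Q"
    unfolding q(4) by (rule q(1)) simp
  have smult: "r \<odot>\<^bsub>?Q\<^esub> X \<in> carrier ?Q" if "r \<in> carrier K" "X \<in> carrier ?Q" for r X
    using rep[OF that(2)] that(1) by (auto simp: q(1,5))
  show ?thesis
  proof (intro moduleI abelian_groupI)
    fix X Y Z assume "X \<in> carrier ?Q" "Y \<in> carrier ?Q" "Z \<in> carrier ?Q"
    then obtain x y z where [simp]: "x \<in> carrier F" "y \<in> carrier F" "z \<in> carrier F"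
      and "X = N +>\<^bsub>F\<^esub> x" "Y = N +>\<^bsub>F\<^esub> y" "Z = N +>\<^bsub>F\<^esub> z"
      using rep by metis
    then show "X \<oplus>\<^bsub>?Q\<^esub> Y \<oplus>\<^bsub>?Q\<^esub> Z = X \<oplus>\<^bsub>?Q\<^esub> (Y \<oplus>\<^bsub>?Q\<^esub> Z)"
      by (simp add: q(3) F.M.a_assoc)
  next
    fix X Y assume "X \<in> carrier ?Q" "Y \<in> carrier ?Q"
    then obtain x y where [simp]: "x \<in> carrier F" "y \<in> carrier F"
      and XY: "X = N +>\<^bsub>F\<^esub> x" "Y = N +>\<^bsub>F\<^esub> y"
      using rep by metis
    show "X \<oplus>\<^bsub>?Q\<^esub> Y = Y \<oplus>\<^bsub>?Q\<^esub> X"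
      by (simp add: XY q(3) F.M.a_comm[of x y])
    fix r assume "r \<in> carrier K"
    then show "r \<odot>\<^bsub>?Q\<^esub> (X \<oplus>\<^bsub>?Q\<^esub> Y) = r \<odot>\<^bsub>?Q\<^esub> X \<oplus>\<^bsub>?Q\<^esub> r \<odot>\<^bsub>?Q\<^esub> Y"
      by (simp add: XY q(3,5) F.smult_r_distr)
  next
    fix X assume "X \<in> carrier ?Q"
    then obtain x where x [simp]: "x \<in> carrier F" and X: "X = N +>\<^bsub>F\<^esub> x"
      using rep by metis
    show "\<zero>\<^bsub>?Q\<^esub> \<oplus>\<^bsub>?Q\<^esub> X = X"
      by (simp add: X q(3,4))
    show "\<one>\<^bsub>K\<^esub> \<odot>\<^bsub>?Q\<^esub> X = X"
      by (simp add: X q(5))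
    show "\<exists>Y\<in>carrier ?Q. Y \<oplus>\<^bsub>?Q\<^esub> X = \<zero>\<^bsub>?Q\<^esub>"
      by (rule bexI[of _ "N +>\<^bsub>F\<^esub> (\<ominus>\<^bsub>F\<^esub> x)"]) (simp_all add: X q(1,3,4) F.M.l_neg)
    fix r s assume rs: "r \<in> carrier K" "s \<in> carrier K"
    show "(r \<oplus>\<^bsub>K\<^esub> s) \<odot>\<^bsub>?Q\<^esub> X = r \<odot>\<^bsub>?Q\<^esub> X \<oplus>\<^bsub>?Q\<^esub> s \<odot>\<^bsub>?Q\<^esub> X"
      using rs by (simp add: X q(3,5) F.smult_l_distr)
    show "(r \<otimes>\<^bsub>K\<^esub> s) \<odot>\<^bsub>?Q\<^esub> X = r \<odot>\<^bsub>?Q\<^esub> (s \<odot>\<^bsub>?Q\<^esub> X)"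
      using rs by (simp add: X q(5) F.smult_assoc1)
  qed (simp_all add: F.is_cring add zero smult)
qed

lemma tensor_gens_closed:
  assumes "module K A" "module K B"
  shows "tensor_gens K A B \<subseteq> carrier (pair_module K A B)"
proof -
  interpret A: module K A by fact
  interpret B: module K B by fact
  interpret F: module K "pair_module K A B"
    by (rule free_module_module[OF A.is_cring])
  note b = basis_vec_carrier[OF A.is_cring, of _ "carrier A \<times> carrier B"]
  show ?thesis
  proof
    fix z assume "z \<in> tensor_gens K A B"
    then show "z \<in> carrier (pair_module K A B)"
      by cases (simp_all del: free_module_simps add: b)
  qed
qed

lemma tensor_rel_submodule:
  assumes "module K A" "module K B"
  shows "submodule (tensor_rel K A B) K (pair_module K A B)"
    and "tensor_gens K A B \<subseteq> tensor_rel K A B"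
proof -
  interpret A: module K A by fact
  interpret F: module K "pair_module K A B"
    by (rule free_module_module[OF A.is_cring])
  show "tensor_gens K A B \<subseteq> tensor_rel K A B"
    by (auto simp: tensor_rel_def)
  have c: "submodule (carrier (pair_module K A B)) K (pair_module K A B)"
    by (rule F.carrier_is_submodule)
  show "submodule (tensor_rel K A B) K (pair_module K A B)"
  proof (rule F.submoduleI)
    show "tensor_rel K A B \<subseteq> carrier (pair_module K A B)"
      unfolding tensor_rel_def using c tensor_gens_closed[OF assms] by blast
    show "\<zero>\<^bsub>pair_module K A B\<^esub> \<in> tensor_rel K A B"
      unfolding tensor_rel_def
      using subgroup.one_closed[OF submodule.axioms(1)]
      by (auto simp del: free_module_simps)
  next
    fix x y assume "x \<in> tensor_rel K A B" "y \<in> tensor_rel K A B"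
    then show "x \<oplus>\<^bsub>pair_module K A B\<^esub> y \<in> tensor_rel K A B"
      unfolding tensor_rel_def using F.submoduleE(5) by blast
  next
    fix x assume "x \<in> tensor_rel K A B"
    then show "\<ominus>\<^bsub>pair_module K A B\<^esub> x \<in> tensor_rel K A B"
      unfolding tensor_rel_def using F.submoduleE(3) by blast
  next
    fix r x assume "r \<in> carrier K" "x \<in> tensor_rel K A B"
    then show "r \<odot>\<^bsub>pair_module K A B\<^esub> x \<in> tensor_rel K A B"
      unfolding tensor_rel_def using F.submoduleE(4) by blast
  qed
qed

lemma tensor_module:
  assumes "module K A" "module K B" shows "module K (tensor K A B)"
  unfolding tensor_def
  by (rule quot_module_module[OF free_module_module[OF module.axioms(1)[OF assms(1)]]
        tensor_rel_submodule(1)[OF assms]])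

lemma pure_tensor_bilinear:
  assumes A: "module K A" and B: "module K B"
  shows "pure_tensor K A B \<in> bilinear_maps K A B (tensor K A B)"
proof -
  interpret A: module K A by fact
  interpret B: module K B by fact
  let ?F = "pair_module K A B" and ?N = "tensor_rel K A B"
  have F: "module K ?F" by (rule free_module_module[OF A.is_cring])
  interpret F: module K ?F by (rule F)
  note N = tensor_rel_submodule[OF A B]
  note q = quot_module_coset[OF F N(1)]
  note b = basis_vec_carrier[OF A.is_cring, of _ "carrier A \<times> carrier B"]
  note g = subsetD[OF N(2)]
  show ?thesis
    unfolding bilinear_maps_def linear_maps_def mem_Collect_eq Pi_iff tensor_def pure_tensor_def
  proof (intro conjI ballI)
    fix a b assume a: "a \<in> carrier A" and b': "b \<in> carrier B"
    have ab: "(a, b) \<in> carrier A \<times> carrier B" using a b' by simp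
    show "?N +>\<^bsub>?F\<^esub> basis_vec K (a, b) \<in> carrier (quot_module K ?F ?N)"
      and "?N +>\<^bsub>?F\<^esub> basis_vec K (a, b) \<in> carrier (quot_module K ?F ?N)"
      by (intro q(1) b ab)+
    show "?N +>\<^bsub>?F\<^esub> basis_vec K (a \<oplus>\<^bsub>A\<^esub> a', b)
        = (?N +>\<^bsub>?F\<^esub> basis_vec K (a, b)) \<oplus>\<^bsub>quot_module K ?F ?N\<^esub> (?N +>\<^bsub>?F\<^esub> basis_vec K (a', b))"
      if a': "a' \<in> carrier A" for a'
    proof -
      have c: "basis_vec K (a, b) \<in> carrier ?F" "basis_vec K (a', b) \<in> carrier ?F"
        "basis_vec K (a \<oplus>\<^bsub>A\<^esub> a', b) \<in> carrier ?F"
        by (rule b; use a a' b' in simp)+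
      show ?thesis
        unfolding q(3)[OF c(1,2)] q(6)[OF c(3) F.M.add.m_closed[OF c(1,2)]]
        by (rule g[OF add_left[OF a a' b']])
    qed
    show "?N +>\<^bsub>?F\<^esub> basis_vec K (a, b \<oplus>\<^bsub>B\<^esub> b2)
        = (?N +>\<^bsub>?F\<^esub> basis_vec K (a, b)) \<oplus>\<^bsub>quot_module K ?F ?N\<^esub> (?N +>\<^bsub>?F\<^esub> basis_vec K (a, b2))"
      if b2: "b2 \<in> carrier B" for b2
    proof -
      have c: "basis_vec K (a, b) \<in> carrier ?F" "basis_vec K (a, b2) \<in> carrier ?F"
        "basis_vec K (a, b \<oplus>\<^bsub>B\<^esub> b2) \<in> carrier ?F"
        by (rule b; use a b2 b' in simp)+
      show ?thesis
        unfolding q(3)[OF c(1,2)] q(6)[OF c(3) F.M.add.m_closed[OF c(1,2)]]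
        by (rule g[OF add_right[OF a b' b2]])
    qed
    fix r assume r: "r \<in> carrier K"
    have c: "basis_vec K (a, b) \<in> carrier ?F" "basis_vec K (r \<odot>\<^bsub>A\<^esub> a, b) \<in> carrier ?F"
      "basis_vec K (a, r \<odot>\<^bsub>B\<^esub> b) \<in> carrier ?F"
      by (rule b; use a r b' in simp)+
    show "?N +>\<^bsub>?F\<^esub> basis_vec K (r \<odot>\<^bsub>A\<^esub> a, b)
        = r \<odot>\<^bsub>quot_module K ?F ?N\<^esub> (?N +>\<^bsub>?F\<^esub> basis_vec K (a, b))"
      unfolding q(5)[OF c(1) r] q(6)[OF c(2) F.smult_closed[OF r c(1)]]
      by (rule g[OF smult_left[OF r a b']])
    show "?N +>\<^bsub>?F\<^esub> basis_vec K (a, r \<odot>\<^bsub>B\<^esub> b)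
        = r \<odot>\<^bsub>quot_module K ?F ?N\<^esub> (?N +>\<^bsub>?F\<^esub> basis_vec K (a, b))"
      unfolding q(5)[OF c(1) r] q(6)[OF c(3) F.smult_closed[OF r c(1)]]
      by (rule g[OF smult_right[OF r a b']])
  qed
qed

text \<open>The linear map out of a tensor product induced by a bilinear map \<open>\<beta>\<close>: it is evaluated on
  a representative of the coset, and \<open>tensor_lift_coset\<close> below
  shows that the choice of the representative does not matter.\<close>

definition tensor_lift ::
  "('k, 'm) ring_scheme \<Rightarrow> ('k, 'c, 'r) module_scheme \<Rightarrow> ('a \<Rightarrow> 'b \<Rightarrow> 'c)
    \<Rightarrow> ('a \<times> 'b \<Rightarrow> 'k) set \<Rightarrow> 'c"
  where "tensor_lift K W \<beta> X = (let x = (SOME x. x \<in> X) in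
      (\<Oplus>\<^bsub>W\<^esub>p\<in>fsupp K x. x p \<odot>\<^bsub>W\<^esub> \<beta> (fst p) (snd p)))"

definition lin_ext ::
  "('k, 'm) ring_scheme \<Rightarrow> ('k, 'c, 'r) module_scheme \<Rightarrow> ('s \<Rightarrow> 'c) \<Rightarrow> ('s \<Rightarrow> 'k) \<Rightarrow> 'c"
  where "lin_ext K W g x = (\<Oplus>\<^bsub>W\<^esub>p\<in>fsupp K x. x p \<odot>\<^bsub>W\<^esub> g p)"

lemma lin_ext:
  assumes W: "module K W" and g: "g \<in> S \<rightarrow> carrier W"
  shows "lin_ext K W g \<in> linear_maps K (free_module K S) W"
    and "p \<in> S \<Longrightarrow> lin_ext K W g (basis_vec K p) = g p"
proof -
  interpret W: module K W by fact
  have ext: "lin_ext K W g x = (\<Oplus>\<^bsub>W\<^esub>p\<in>U. x p \<odot>\<^bsub>W\<^esub> g p)"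
    if "finite U" "fsupp K x \<subseteq> U" "U \<subseteq> S" "\<forall>p. x p \<in> carrier K" for x U
    unfolding lin_ext_def
    by (rule W.M.add.finprod_mono_neutral_cong_left)
      (use that g in \<open>auto simp: fsupp_def Pi_def intro!: W.smult_l_null\<close>)
  show "lin_ext K W g \<in> linear_maps K (free_module K S) W"
    unfolding linear_maps_def
  proof (intro CollectI conjI ballI funcsetI)
    fix x assume x: "x \<in> carrier (free_module K S)"
    show "lin_ext K W g x \<in> carrier W"
      unfolding lin_ext_def
      by (rule W.M.finsum_closed) (use x g in \<open>auto simp: free_module_carrier Pi_def\<close>)
    show "lin_ext K W g (r \<odot>\<^bsub>free_module K S\<^esub> x) = r \<odot>\<^bsub>W\<^esub> lin_ext K W g x"
      if r: "r \<in> carrier K" for r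
    proof -
      have "lin_ext K W g (r \<odot>\<^bsub>free_module K S\<^esub> x)
          = (\<Oplus>\<^bsub>W\<^esub>p\<in>fsupp K x. (r \<otimes>\<^bsub>K\<^esub> x p) \<odot>\<^bsub>W\<^esub> g p)"
        by (subst ext[of "fsupp K x"]) (use x r in \<open>auto simp: free_module_carrier fsupp_def\<close>)
      also have "\<dots> = (\<Oplus>\<^bsub>W\<^esub>p\<in>fsupp K x. r \<odot>\<^bsub>W\<^esub> (x p \<odot>\<^bsub>W\<^esub> g p))"
        by (rule W.M.finsum_cong')
          (use x r g in \<open>auto simp: free_module_carrier Pi_def subset_iff W.smult_assoc1\<close>)
      also have "\<dots> = r \<odot>\<^bsub>W\<^esub> lin_ext K W g x"
        unfolding lin_ext_def
        by (rule W.finsum_smult_ldistr[symmetric])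
          (use x r g in \<open>auto simp: free_module_carrier Pi_def subset_iff\<close>)
      finally show ?thesis .
    qed
    show "lin_ext K W g (x \<oplus>\<^bsub>free_module K S\<^esub> y) = lin_ext K W g x \<oplus>\<^bsub>W\<^esub> lin_ext K W g y"
      if y: "y \<in> carrier (free_module K S)" for y
    proof -
      let ?U = "fsupp K x \<union> fsupp K y"
      have U: "finite ?U" "?U \<subseteq> S" using x y by (auto simp: free_module_carrier)
      have xy: "\<forall>p. x p \<in> carrier K" "\<forall>p. y p \<in> carrier K"
        using x y by (auto simp: free_module_carrier)
      have "fsupp K (\<lambda>p. x p \<oplus>\<^bsub>K\<^esub> y p) \<subseteq> ?U" by (auto simp: fsupp_def)
      then have "lin_ext K W g (x \<oplus>\<^bsub>free_module K S\<^esub> y)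
          = (\<Oplus>\<^bsub>W\<^esub>p\<in>?U. (x p \<oplus>\<^bsub>K\<^esub> y p) \<odot>\<^bsub>W\<^esub> g p)"
        by (subst ext[of ?U]) (use U xy in auto)
      also have "\<dots> = (\<Oplus>\<^bsub>W\<^esub>p\<in>?U. x p \<odot>\<^bsub>W\<^esub> g p \<oplus>\<^bsub>W\<^esub> y p \<odot>\<^bsub>W\<^esub> g p)"
        by (rule W.M.finsum_cong') (use U xy g in \<open>auto simp: Pi_def subset_iff W.smult_l_distr\<close>)
      also have "\<dots> = (\<Oplus>\<^bsub>W\<^esub>p\<in>?U. x p \<odot>\<^bsub>W\<^esub> g p) \<oplus>\<^bsub>W\<^esub> (\<Oplus>\<^bsub>W\<^esub>p\<in>?U. y p \<odot>\<^bsub>W\<^esub> g p)"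
        by (rule W.M.finsum_addf) (use U xy g in \<open>auto simp: Pi_def subset_iff\<close>)
      also have "\<dots> = lin_ext K W g x \<oplus>\<^bsub>W\<^esub> lin_ext K W g y"
        by (subst (1 2) ext[of ?U]) (use U xy in auto)
      finally show ?thesis .
    qed
  qed
  show "lin_ext K W g (basis_vec K p) = g p" if p: "p \<in> S"
  proof -
    have "lin_ext K W g (basis_vec K p) = (\<Oplus>\<^bsub>W\<^esub>q\<in>{p}. basis_vec K p q \<odot>\<^bsub>W\<^esub> g q)"
      by (rule ext) (use p in \<open>auto simp: fsupp_def basis_vec_def\<close>)
    also have "\<dots> = g p"
      using p g by (auto simp: basis_vec_def Pi_def)
    finally show ?thesis .
  qed
qed

lemma tensor_lift_coset:
  assumes A: "module K A" and B: "module K B" and W: "module K W"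
    and \<beta>: "\<beta> \<in> bilinear_maps K A B W" and x: "x \<in> carrier (pair_module K A B)"
  shows "tensor_lift K W \<beta> (tensor_rel K A B +>\<^bsub>pair_module K A B\<^esub> x)
    = lin_ext K W (\<lambda>p. \<beta> (fst p) (snd p)) x"
proof -
  interpret A: module K A by fact
  interpret B: module K B by fact
  interpret W: module K W by fact
  let ?F = "pair_module K A B" and ?N = "tensor_rel K A B"
  let ?e = "lin_ext K W (\<lambda>p. \<beta> (fst p) (snd p))"
  have F: "module K ?F" by (rule free_module_module[OF A.is_cring])
  interpret F: module K ?F by (rule F)
  note N = tensor_rel_submodule[OF A B]
  interpret N: submodule ?N K ?F by (rule N(1))
  note b = basis_vec_carrier[OF A.is_cring, of _ "carrier A \<times> carrier B"]
  note \<beta>D = bilinear_mapsD[OF \<beta>]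
  have g: "(\<lambda>p. \<beta> (fst p) (snd p)) \<in> carrier A \<times> carrier B \<rightarrow> carrier W"
    using \<beta>D(1) by auto
  note e = lin_ext(1)[OF W g] and eb = lin_ext(2)[OF W g]
  note eD = linear_mapsD[OF e]
  let ?Z = "{n \<in> carrier ?F. ?e n = \<zero>\<^bsub>W\<^esub>}"
  have Zsub: "submodule ?Z K ?F"
  proof (rule F.submoduleI)
    show "\<ominus>\<^bsub>?F\<^esub> n \<in> ?Z" if "n \<in> ?Z" for n
      using that linear_maps_minus[OF e F W F.M.zero_closed, of n] linear_maps_zero[OF e F W]
      by (simp add: F.M.minus_eq W.M.minus_eq del: free_module_simps)
  qed (auto simp: eD linear_maps_zero[OF e F W] simp del: free_module_simps)
  have gens: "tensor_gens K A B \<subseteq> ?Z"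
  proof
    fix z assume z: "z \<in> tensor_gens K A B"
    have "z \<in> carrier ?F" using z tensor_gens_closed[OF A B] by blast
    moreover have "?e z = \<zero>\<^bsub>W\<^esub>"
      using z
      by cases (simp_all add: linear_maps_minus[OF e F W] eD eb b \<beta>D F.M.add.m_closed F.smult_closed
          W.M.r_neg W.M.minus_eq del: free_module_simps)
    ultimately show "z \<in> ?Z" by simp
  qed
  have Z: "?N \<subseteq> ?Z" using Zsub gens by (auto simp: tensor_rel_def)
  let ?X = "?N +>\<^bsub>?F\<^esub> x"
  have "x \<in> ?X"
    using N.one_closed x F.M.l_zero[OF x] unfolding a_r_coset_def' by fastforce
  then have "(SOME y. y \<in> ?X) \<in> ?X" using some_in_eq by blast
  then obtain n where n: "n \<in> ?N" "(SOME y. y \<in> ?X) = n \<oplus>\<^bsub>?F\<^esub> x"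
    by (auto simp: a_r_coset_def' simp del: free_module_simps)
  have "tensor_lift K W \<beta> ?X = ?e (n \<oplus>\<^bsub>?F\<^esub> x)"
    unfolding tensor_lift_def Let_def n(2) lin_ext_def ..
  also have "\<dots> = ?e n \<oplus>\<^bsub>W\<^esub> ?e x"
    by (rule eD(2)) (use n x Z in auto)
  also have "\<dots> = ?e x"
    using n Z eD(1)[OF x] by auto
  finally show ?thesis .
qed

lemma tensor_lift_linear:
  assumes A: "module K A" and B: "module K B" and W: "module K W"
    and \<beta>: "\<beta> \<in> bilinear_maps K A B W"
  shows "tensor_lift K W \<beta> \<in> linear_maps K (tensor K A B) W"
proof -
  interpret A: module K A by fact
  let ?F = "pair_module K A B"
  have F: "module K ?F" by (rule free_module_module[OF A.is_cring])
  interpret F: module K ?F by (rule F)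
  note q = quot_module_coset[OF F tensor_rel_submodule(1)[OF A B]]
  have g: "(\<lambda>p. \<beta> (fst p) (snd p)) \<in> carrier A \<times> carrier B \<rightarrow> carrier W"
    using bilinear_mapsD(1)[OF \<beta>] by auto
  note eD = linear_mapsD[OF lin_ext(1)[OF W g]]
  note l = tensor_lift_coset[OF A B W \<beta>]
  show ?thesis
    unfolding linear_maps_def tensor_def
    by (auto dest!: q(2) simp: q(3,5) l eD F.M.add.m_closed F.smult_closed simp del: free_module_simps)
qed

lemma tensor_lift_pure:
  assumes A: "module K A" and B: "module K B" and W: "module K W"
    and \<beta>: "\<beta> \<in> bilinear_maps K A B W" and a: "a \<in> carrier A" and b: "b \<in> carrier B"
  shows "tensor_lift K W \<beta> (pure_tensor K A B a b) = \<beta> a b"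
proof -
  interpret A: module K A by fact
  have g: "(\<lambda>p. \<beta> (fst p) (snd p)) \<in> carrier A \<times> carrier B \<rightarrow> carrier W"
    using bilinear_mapsD(1)[OF \<beta>] by auto
  show ?thesis
    unfolding pure_tensor_def
    by (subst tensor_lift_coset[OF A B W \<beta>])
      (use a b lin_ext(2)[OF W g, of "(a, b)"] in \<open>auto intro: basis_vec_carrier A.is_cring\<close>)
qed

text \<open>\<open>tensor_map K A B f g\<close> is \<open>f \<otimes> g\<close>, where \<open>A\<close> and \<open>B\<close> are the \<^emph>\<open>codomains\<close> of \<open>f\<close> and \<open>g\<close>.\<close>

definition tensor_map ::
  "('k, 'm) ring_scheme \<Rightarrow> ('k, 'a, 'p) module_scheme \<Rightarrow> ('k, 'b, 'q) module_scheme
    \<Rightarrow> ('c \<Rightarrow> 'a) \<Rightarrow> ('d \<Rightarrow> 'b) \<Rightarrow> ('c \<times> 'd \<Rightarrow> 'k) set \<Rightarrow> ('a \<times> 'b \<Rightarrow> 'k) set"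
  where "tensor_map K A B f g =
      tensor_lift K (tensor K A B) (\<lambda>c d. pure_tensor K A B (f c) (g d))"

text \<open>The canonical isomorphism from \<open>(A \<otimes> B) \<otimes> D\<close> to \<open>A \<otimes> (B \<otimes> D)\<close>.\<close>

definition tensor_assoc ::
  "('k, 'm) ring_scheme \<Rightarrow> ('k, 'a, 'p) module_scheme \<Rightarrow> ('k, 'b, 'q) module_scheme
    \<Rightarrow> ('k, 'd, 'r) module_scheme \<Rightarrow> (('a \<times> 'b \<Rightarrow> 'k) set \<times> 'd \<Rightarrow> 'k) set
    \<Rightarrow> ('a \<times> ('b \<times> 'd \<Rightarrow> 'k) set \<Rightarrow> 'k) set"
  where "tensor_assoc K A B D =
      tensor_lift K (tensor K A (tensor K B D)) (\<lambda>t d.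
        tensor_lift K (tensor K A (tensor K B D))
          (\<lambda>a b. pure_tensor K A (tensor K B D) a (pure_tensor K B D b d)) t)"


section \<open>Coalgebras and comodules\<close>

locale noncounitary_coalgebra = K: field K + C: module K C
  for K :: "('k, 'm) ring_scheme" and C :: "('k, 'c, 'p) module_scheme" +
  fixes \<Delta> :: "'c \<Rightarrow> ('c \<times> 'c \<Rightarrow> 'k) set"
  assumes comult_linear: "\<Delta> \<in> linear_maps K C (tensor K C C)"
    and coassoc: "\<And>c. c \<in> carrier C \<Longrightarrow>
      tensor_map K C (tensor K C C) id \<Delta> (\<Delta> c)
      = tensor_assoc K C C C (tensor_map K (tensor K C C) C \<Delta> id (\<Delta> c))"

locale coalgebra = noncounitary_coalgebra K C \<Delta>
  for K :: "('k, 'm) ring_scheme" and C :: "('k, 'c, 'p) module_scheme" and \<Delta> +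
  fixes \<epsilon> :: "'c \<Rightarrow> 'k"
  assumes counit_linear: "\<epsilon> \<in> linear_maps K C (scalar_module K)"
    and counit_left: "\<And>c. c \<in> carrier C \<Longrightarrow>
      tensor_map K (scalar_module K) C \<epsilon> id (\<Delta> c) = pure_tensor K (scalar_module K) C \<one>\<^bsub>K\<^esub> c"
    and counit_right: "\<And>c. c \<in> carrier C \<Longrightarrow>
      tensor_map K C (scalar_module K) id \<epsilon> (\<Delta> c) = pure_tensor K C (scalar_module K) c \<one>\<^bsub>K\<^esub>"

locale noncounitary_comodule = noncounitary_coalgebra K C \<Delta> + M: module K M
  for K :: "('k, 'm) ring_scheme" and C :: "('k, 'c, 'p) module_scheme" and \<Delta>
    and M :: "('k, 'a, 'q) module_scheme" +
  fixes \<rho> :: "'a \<Rightarrow> ('c \<times> 'a \<Rightarrow> 'k) set"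
  assumes coact_linear: "\<rho> \<in> linear_maps K M (tensor K C M)"
    and coact_coassoc: "\<And>m. m \<in> carrier M \<Longrightarrow>
      tensor_map K C (tensor K C M) id \<rho> (\<rho> m)
      = tensor_assoc K C C M (tensor_map K (tensor K C C) M \<Delta> id (\<rho> m))"

locale comodule = coalgebra K C \<Delta> \<epsilon> + noncounitary_comodule K C \<Delta> M \<rho>
  for K :: "('k, 'm) ring_scheme" and C :: "('k, 'c, 'p) module_scheme" and \<Delta> \<epsilon>
    and M :: "('k, 'a, 'q) module_scheme" and \<rho> +
  assumes coact_counit: "\<And>m. m \<in> carrier M \<Longrightarrow>
      tensor_map K (scalar_module K) M \<epsilon> id (\<rho> m) = pure_tensor K (scalar_module K) M \<one>\<^bsub>K\<^esub> m"


section \<open>Rota-Baxter structures of weight \<open>w\<close>\<close>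

locale noncounitary_rota_baxter_coalgebra = noncounitary_coalgebra K C \<Delta>
  for K :: "('k, 'm) ring_scheme" and w :: 'k
    and C :: "('k, 'c, 'p) module_scheme" and \<Delta> +
  fixes P :: "'c \<Rightarrow> 'c"
  assumes weight_closed: "w \<in> carrier K"
    and P_linear: "P \<in> linear_maps K C C"
    and rota_baxter: "\<And>c. c \<in> carrier C \<Longrightarrow>
      tensor_map K C C P P (\<Delta> c)
      = tensor_map K C C P id (\<Delta> (P c))
        \<oplus>\<^bsub>tensor K C C\<^esub> tensor_map K C C id P (\<Delta> (P c))
        \<oplus>\<^bsub>tensor K C C\<^esub> w \<odot>\<^bsub>tensor K C C\<^esub> \<Delta> (P c)"

locale rota_baxter_coalgebra =
  coalgebra K C \<Delta> \<epsilon> + noncounitary_rota_baxter_coalgebra K w C \<Delta> P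
  for K :: "('k, 'm) ring_scheme" and w :: 'k
    and C :: "('k, 'c, 'p) module_scheme" and \<Delta> \<epsilon> P

text \<open>A Rota-Baxter paired comodule does not require \<open>P\<close> to be a Rota-Baxter operator on \<open>C\<close>.\<close>

locale noncounitary_rota_baxter_paired_comodule = noncounitary_comodule K C \<Delta> M \<rho>
  for K :: "('k, 'm) ring_scheme" and w :: 'k
    and C :: "('k, 'c, 'p) module_scheme" and \<Delta>
    and M :: "('k, 'a, 'q) module_scheme" and \<rho> +
  fixes P :: "'c \<Rightarrow> 'c" and T :: "'a \<Rightarrow> 'a"
  assumes weight_closed: "w \<in> carrier K"
    and P_linear: "P \<in> linear_maps K C C"
    and T_linear: "T \<in> linear_maps K M M"
    and rota_baxter_paired: "\<And>m. m \<in> carrier M \<Longrightarrow>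
      tensor_map K C M P T (\<rho> m)
      = tensor_map K C M P id (\<rho> (T m))
        \<oplus>\<^bsub>tensor K C M\<^esub> tensor_map K C M id T (\<rho> (T m))
        \<oplus>\<^bsub>tensor K C M\<^esub> w \<odot>\<^bsub>tensor K C M\<^esub> \<rho> (T m)"

locale rota_baxter_paired_comodule =
  comodule K C \<Delta> \<epsilon> M \<rho> + noncounitary_rota_baxter_paired_comodule K w C \<Delta> M \<rho> P T
  for K :: "('k, 'm) ring_scheme" and w :: 'k
    and C :: "('k, 'c, 'p) module_scheme" and \<Delta> \<epsilon>
    and M :: "('k, 'a, 'q) module_scheme" and \<rho> P T

definition derived_comult ::
  "('k, 'm) ring_scheme \<Rightarrow> 'k \<Rightarrow> ('k, 'c, 'p) module_scheme \<Rightarrow> ('c \<Rightarrow> ('c \<times> 'c \<Rightarrow> 'k) set)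
    \<Rightarrow> ('c \<Rightarrow> 'c) \<Rightarrow> 'c \<Rightarrow> ('c \<times> 'c \<Rightarrow> 'k) set"
  where "derived_comult K w C \<Delta> P = (\<lambda>c.
      tensor_map K C C id P (\<Delta> c)
      \<oplus>\<^bsub>tensor K C C\<^esub> tensor_map K C C P id (\<Delta> c)
      \<oplus>\<^bsub>tensor K C C\<^esub> w \<odot>\<^bsub>tensor K C C\<^esub> \<Delta> c)"

definition derived_coact ::
  "('k, 'm) ring_scheme \<Rightarrow> 'k \<Rightarrow> ('k, 'c, 'p) module_scheme \<Rightarrow> ('k, 'a, 'q) module_scheme
    \<Rightarrow> ('a \<Rightarrow> ('c \<times> 'a \<Rightarrow> 'k) set) \<Rightarrow> ('c \<Rightarrow> 'c) \<Rightarrow> ('a \<Rightarrow> 'a) \<Rightarrow> 'a \<Rightarrow> ('c \<times> 'a \<Rightarrow> 'k) set"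
  where "derived_coact K w C M \<rho> P T = (\<lambda>m.
      tensor_map K C M P id (\<rho> m)
      \<oplus>\<^bsub>tensor K C M\<^esub> tensor_map K C M id T (\<rho> m)
      \<oplus>\<^bsub>tensor K C M\<^esub> w \<odot>\<^bsub>tensor K C M\<^esub> \<rho> m)"

end

(* Write f.g.h for the tensor product of three maps. The identity (b) is the Rota-Baxter
   condition itself. It turns the term of (id (x) rho') rho' containing rho' T into id.P.T, and the
   analogous identity Delta' P = (P (x) P) Delta turns the term of (Delta' (x) id) rho' containing
   Delta' P into P.P.id. Both sides then equal
     P.P.id + P.id.T + id.P.T + w (P.id.id + id.P.id + id.id.T) + w^2 id.id.id
   applied to the iterated coaction, which proves (c). The Rota-Baxter identity for rho' follows
   by applying P (x) T to the definition of rho' and using (b). Finally (a) is the case M = C,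
   rho = Delta, T = P of (c) and (d). *)
theory Submission
  imports Defs
begin

section \<open>Functoriality of the tensor product\<close>

text \<open>Both syntactic forms of the identity occur: \<open>id\<close> in the coassociativity and
  Rota-Baxter axioms, the abstraction when maps are composed pointwise.\<close>

lemma id_linear: "(\<lambda>x. x) \<in> linear_maps K V V" "id \<in> linear_maps K V V"
  by (simp_all add: linear_maps_def)

lemma linear_maps_comp:
  assumes "g \<in> linear_maps K V W" and "f \<in> linear_maps K U V"
  shows "(\<lambda>x. g (f x)) \<in> linear_maps K U W"
  using assms by (auto simp: linear_maps_def Pi_iff)

lemma linear_maps_add:
  assumes W: "module K W" and f: "f \<in> linear_maps K V W" and g: "g \<in> linear_maps K V W"
  shows "(\<lambda>x. f x \<oplus>\<^bsub>W\<^esub> g x) \<in> linear_maps K V W"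
proof -
  interpret W: module K W by fact
  note c = linear_mapsD(1)[OF f] linear_mapsD(1)[OF g]
  show ?thesis
    unfolding linear_maps_def
    by (auto simp: c linear_mapsD(2,3)[OF f] linear_mapsD(2,3)[OF g] W.M.a_ac W.smult_r_distr)
qed

lemma linear_maps_smult:
  assumes W: "module K W" and f: "f \<in> linear_maps K V W" and r: "r \<in> carrier K"
  shows "(\<lambda>x. r \<odot>\<^bsub>W\<^esub> f x) \<in> linear_maps K V W"
proof -
  interpret W: module K W by fact
  note c = linear_mapsD(1)[OF f]
  show ?thesis
    unfolding linear_maps_def
    by (auto simp: c r linear_mapsD(2,3)[OF f] W.smult_r_distr W.smult_assoc1[symmetric] W.R.m_comm)
qed

text \<open>Linearity constrains a function on the carrier alone, so two HOL functions that
  represent the same map may differ outside it. This lemma carries linearity from one to the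
  other.\<close>

lemma linear_maps_cong:
  assumes V: "module K V" and f: "f \<in> linear_maps K V W"
    and eq: "\<And>x. x \<in> carrier V \<Longrightarrow> f x = g x"
  shows "g \<in> linear_maps K V W"
proof -
  interpret V: module K V by fact
  have "g x \<in> carrier W" if "x \<in> carrier V" for x
    using linear_mapsD(1)[OF f that] eq[OF that] by simp
  moreover have "g (x \<oplus>\<^bsub>V\<^esub> y) = g x \<oplus>\<^bsub>W\<^esub> g y" if "x \<in> carrier V" "y \<in> carrier V" for x y
    using linear_mapsD(2)[OF f that] that by (simp add: eq)
  moreover have "g (r \<odot>\<^bsub>V\<^esub> x) = r \<odot>\<^bsub>W\<^esub> g x" if "r \<in> carrier K" "x \<in> carrier V" for r x
    using linear_mapsD(3)[OF f that] that by (simp add: eq)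
  ultimately show ?thesis by (auto simp: linear_maps_def)
qed

section \<open>Pure tensors generate the tensor product\<close>

text \<open>Finite support makes every element of the free module a finite linear combination of
  basis vectors, which can be built up one term at a time.\<close>

lemma basis_vec_induct:
  assumes K: "cring K" and x: "x \<in> carrier (free_module K S)"
    and zero: "Q (\<lambda>p. \<zero>\<^bsub>K\<^esub>)"
    and step: "\<And>y r p. \<lbrakk>y \<in> carrier (free_module K S); Q y; r \<in> carrier K; p \<in> S\<rbrakk>
      \<Longrightarrow> Q (y \<oplus>\<^bsub>free_module K S\<^esub> (r \<odot>\<^bsub>free_module K S\<^esub> basis_vec K p))"
  shows "Q x"
proof -
  interpret cring K by fact
  \<comment> \<open>The induction runs over an arbitrary finite superset \<open>U\<close> of the
    support, so that only an inclusion has to be maintained.\<close>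
  have "Q x" if "finite U" "fsupp K x \<subseteq> U" "x \<in> carrier (free_module K S)" for U x
    using that
  proof (induction U arbitrary: x rule: finite_induct)
    case empty
    then have "x = (\<lambda>p. \<zero>\<^bsub>K\<^esub>)" by (auto simp: fsupp_def)
    with zero show ?case by simp
  next
    case (insert p U)
    show ?case
    proof (cases "p \<in> fsupp K x")
      case False
      with insert.prems have "fsupp K x \<subseteq> U" by auto
      with insert.prems insert.IH show ?thesis by blast
    next
      case True
      \<comment> \<open>Erasing the coefficient at \<open>p\<close> removes \<open>p\<close> from
        the support; adding back \<open>x p\<close> times the basis vector at \<open>p\<close>
        recovers \<open>x\<close>.\<close>
      let ?y = "x(p := \<zero>\<^bsub>K\<^esub>)"
      have y: "?y \<in> carrier (free_module K S)" "fsupp K ?y \<subseteq> U"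
        using insert.prems
        by (auto simp: free_module_carrier fsupp_def intro: rev_finite_subset[of "{p. x p \<noteq> \<zero>\<^bsub>K\<^esub>}"])
      have p: "p \<in> S" and xc: "\<And>q. x q \<in> carrier K"
        using True insert.prems by (auto simp: free_module_carrier)
      have x: "x = ?y \<oplus>\<^bsub>free_module K S\<^esub> (x p \<odot>\<^bsub>free_module K S\<^esub> basis_vec K p)"
        using xc by (auto simp: basis_vec_def fun_eq_iff)
      show ?thesis
        by (subst x) (rule step[OF y(1) insert.IH[OF y(2,1)] xc p])
    qed
  qed
  with x show ?thesis by (auto simp: free_module_carrier)
qed

text \<open>This is the uniqueness half of the universal property. A tensor is the coset of a
  combination of basis vectors, the coset map is linear, and the coset of a basis vector is a pure
  tensor. The identities between tensor maps below are reduced to pure tensors by it.\<close>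

lemma linear_maps_tensor_eqI:
  assumes A: "module K A" and B: "module K B" and W: "module K W"
    and f: "f \<in> linear_maps K (tensor K A B) W" and g: "g \<in> linear_maps K (tensor K A B) W"
    and eq: "\<And>a b. \<lbrakk>a \<in> carrier A; b \<in> carrier B\<rbrakk>
      \<Longrightarrow> f (pure_tensor K A B a b) = g (pure_tensor K A B a b)"
    and t: "t \<in> carrier (tensor K A B)"
  shows "f t = g t"
proof -
  interpret A: module K A by fact
  let ?F = "pair_module K A B" and ?N = "tensor_rel K A B"
  have F: "module K ?F" by (rule free_module_module[OF A.is_cring])
  interpret F: module K ?F by (rule F)
  note q = quot_module_coset[OF F tensor_rel_submodule(1)[OF A B], folded tensor_def]
  note b = basis_vec_carrier[OF A.is_cring, of _ "carrier A \<times> carrier B"]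
  have T: "module K (tensor K A B)" by (rule tensor_module[OF A B])
  obtain x where x: "x \<in> carrier ?F" and tx: "t = ?N +>\<^bsub>?F\<^esub> x"
    using q(2)[OF t] by blast
  have "f (?N +>\<^bsub>?F\<^esub> x) = g (?N +>\<^bsub>?F\<^esub> x)"
    using A.is_cring x
  proof (rule basis_vec_induct)
    show "f (?N +>\<^bsub>?F\<^esub> (\<lambda>p. \<zero>\<^bsub>K\<^esub>)) = g (?N +>\<^bsub>?F\<^esub> (\<lambda>p. \<zero>\<^bsub>K\<^esub>))"
      using linear_maps_zero[OF f T W] linear_maps_zero[OF g T W] q(4) by simp
  next
    fix y r p
    assume y: "y \<in> carrier ?F" and IH: "f (?N +>\<^bsub>?F\<^esub> y) = g (?N +>\<^bsub>?F\<^esub> y)"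
      and r: "r \<in> carrier K" and p: "p \<in> carrier A \<times> carrier B"
    obtain u v where uv: "p = (u, v)" "u \<in> carrier A" "v \<in> carrier B" using p by auto
    have bp: "basis_vec K p \<in> carrier ?F" by (rule b[OF p])
    have e: "f (?N +>\<^bsub>?F\<^esub> basis_vec K p) = g (?N +>\<^bsub>?F\<^esub> basis_vec K p)"
      using eq[OF uv(2,3)] by (simp add: pure_tensor_def uv(1))
    have s: "?N +>\<^bsub>?F\<^esub> (y \<oplus>\<^bsub>?F\<^esub> (r \<odot>\<^bsub>?F\<^esub> basis_vec K p))
        = (?N +>\<^bsub>?F\<^esub> y) \<oplus>\<^bsub>tensor K A B\<^esub> (r \<odot>\<^bsub>tensor K A B\<^esub> (?N +>\<^bsub>?F\<^esub> basis_vec K p))"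
      using q(3)[OF y F.smult_closed[OF r bp]] q(5)[OF bp r] by simp
    have cy: "?N +>\<^bsub>?F\<^esub> y \<in> carrier (tensor K A B)" by (rule q(1)[OF y])
    have cb: "?N +>\<^bsub>?F\<^esub> basis_vec K p \<in> carrier (tensor K A B)" by (rule q(1)[OF bp])
    have cr: "r \<odot>\<^bsub>tensor K A B\<^esub> (?N +>\<^bsub>?F\<^esub> basis_vec K p) \<in> carrier (tensor K A B)"
      by (rule module.smult_closed[OF T r cb])
    show "f (?N +>\<^bsub>?F\<^esub> (y \<oplus>\<^bsub>?F\<^esub> (r \<odot>\<^bsub>?F\<^esub> basis_vec K p)))
        = g (?N +>\<^bsub>?F\<^esub> (y \<oplus>\<^bsub>?F\<^esub> (r \<odot>\<^bsub>?F\<^esub> basis_vec K p)))"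
      unfolding s linear_mapsD(2)[OF f cy cr] linear_mapsD(2)[OF g cy cr]
        linear_mapsD(3)[OF f r cb] linear_mapsD(3)[OF g r cb] IH e ..
  qed
  with tx show ?thesis by simp
qed

section \<open>Tensor products of linear maps\<close>

lemma bilinear_maps_comp:
  assumes \<beta>: "\<beta> \<in> bilinear_maps K A B W"
    and f: "f \<in> linear_maps K A' A" and g: "g \<in> linear_maps K B' B"
  shows "(\<lambda>a b. \<beta> (f a) (g b)) \<in> bilinear_maps K A' B' W"
  unfolding bilinear_maps_def linear_maps_def mem_Collect_eq Pi_iff
  by (intro conjI ballI)
    (simp_all only: linear_mapsD[OF f] linear_mapsD[OF g] bilinear_mapsD[OF \<beta>])

lemma pure_tensor_closed:
  assumes "module K A" "module K B" "a \<in> carrier A" "b \<in> carrier B"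
  shows "pure_tensor K A B a b \<in> carrier (tensor K A B)"
  by (rule bilinear_mapsD(1)[OF pure_tensor_bilinear[OF assms(1,2)] assms(3,4)])

lemma tensor_map_linear:
  assumes "module K A" "module K B" "module K A'" "module K B'"
    and "f \<in> linear_maps K A A'" "g \<in> linear_maps K B B'"
  shows "tensor_map K A' B' f g \<in> linear_maps K (tensor K A B) (tensor K A' B')"
  unfolding tensor_map_def
  by (intro tensor_lift_linear tensor_module bilinear_maps_comp[OF pure_tensor_bilinear] assms)

lemma tensor_map_pure:
  assumes "module K A" "module K B" "module K A'" "module K B'"
    and "f \<in> linear_maps K A A'" "g \<in> linear_maps K B B'"
    and "a \<in> carrier A" "b \<in> carrier B"
  shows "tensor_map K A' B' f g (pure_tensor K A B a b) = pure_tensor K A' B' (f a) (g b)"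
  unfolding tensor_map_def
  by (rule tensor_lift_pure) (intro tensor_module bilinear_maps_comp[OF pure_tensor_bilinear] assms)+

text \<open>Identities such as \<rho>' T = (P \<otimes> T) \<rho> hold on carriers only, so
  rewriting cannot be used inside a factor of \<open>tensor_map\<close>. Comparison on pure tensors
  evaluates the factors at elements of the carriers alone.\<close>

lemma tensor_map_cong:
  assumes A: "module K A" and B: "module K B" and A': "module K A'" and B': "module K B'"
    and f: "f \<in> linear_maps K A A'" and g: "g \<in> linear_maps K B B'"
    and ff: "\<And>a. a \<in> carrier A \<Longrightarrow> f a = f' a" and gg: "\<And>b. b \<in> carrier B \<Longrightarrow> g b = g' b"
    and t: "t \<in> carrier (tensor K A B)"
  shows "tensor_map K A' B' f g t = tensor_map K A' B' f' g' t"
proof -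
  have f': "f' \<in> linear_maps K A A'" by (rule linear_maps_cong[OF A f ff])
  have g': "g' \<in> linear_maps K B B'" by (rule linear_maps_cong[OF B g gg])
  show ?thesis
    by (rule linear_maps_tensor_eqI[OF A B tensor_module[OF A' B']
          tensor_map_linear[OF A B A' B' f g] tensor_map_linear[OF A B A' B' f' g'] _ t])
      (simp add: tensor_map_pure[OF A B A' B' f g] tensor_map_pure[OF A B A' B' f' g'] ff gg)
qed

lemma tensor_map_ident:
  assumes A: "module K A" and B: "module K B" and t: "t \<in> carrier (tensor K A B)"
  shows "tensor_map K A B (\<lambda>x. x) (\<lambda>x. x) t = t"
  by (rule linear_maps_tensor_eqI[OF A B tensor_module[OF A B]
        tensor_map_linear[OF A B A B id_linear(1) id_linear(1)] id_linear(1) _ t])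
    (rule tensor_map_pure[OF A B A B id_linear(1) id_linear(1)])

text \<open>On a \<otimes> b both sides give f' (f a) \<otimes> g' (g b), and both are linear in the
  tensor.\<close>

lemma tensor_map_comp:
  assumes A: "module K A" and B: "module K B" and A': "module K A'" and B': "module K B'"
    and A'': "module K A''" and B'': "module K B''"
    and f: "f \<in> linear_maps K A A'" and g: "g \<in> linear_maps K B B'"
    and f': "f' \<in> linear_maps K A' A''" and g': "g' \<in> linear_maps K B' B''"
    and t: "t \<in> carrier (tensor K A B)"
  shows "tensor_map K A'' B'' f' g' (tensor_map K A' B' f g t)
    = tensor_map K A'' B'' (\<lambda>x. f' (f x)) (\<lambda>x. g' (g x)) t"
proof -
  note ff = linear_maps_comp[OF f' f] and gg = linear_maps_comp[OF g' g]
  note l = tensor_map_linear[OF A B A' B' f g] tensor_map_linear[OF A' B' A'' B'' f' g']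
  show ?thesis
    by (rule linear_maps_tensor_eqI[OF A B tensor_module[OF A'' B'']
          linear_maps_comp[OF l(2,1)] tensor_map_linear[OF A B A'' B'' ff gg] _ t])
      (simp add: tensor_map_pure[OF A B A' B' f g] tensor_map_pure[OF A' B' A'' B'' f' g']
        tensor_map_pure[OF A B A'' B'' ff gg] linear_mapsD(1)[OF f] linear_mapsD(1)[OF g])
qed

section \<open>Bilinearity of f \<otimes> g in f and g\<close>

lemma tensor_map_add_left:
  assumes A: "module K A" and B: "module K B" and A': "module K A'" and B': "module K B'"
    and f: "f \<in> linear_maps K A A'" and f': "f' \<in> linear_maps K A A'"
    and g: "g \<in> linear_maps K B B'"
    and t: "t \<in> carrier (tensor K A B)"
  shows "tensor_map K A' B' (\<lambda>x. f x \<oplus>\<^bsub>A'\<^esub> f' x) g t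
    = tensor_map K A' B' f g t \<oplus>\<^bsub>tensor K A' B'\<^esub> tensor_map K A' B' f' g t"
proof -
  note h = linear_maps_add[OF A' f f']
  note l = tensor_map_linear[OF A B A' B' _ g]
  show ?thesis
    by (rule linear_maps_tensor_eqI[OF A B tensor_module[OF A' B']
          l[OF h] linear_maps_add[OF tensor_module[OF A' B'] l[OF f] l[OF f']] _ t])
      (simp add: tensor_map_pure[OF A B A' B' _ g] f f' h
        bilinear_mapsD(2)[OF pure_tensor_bilinear[OF A' B']]
        linear_mapsD(1)[OF f] linear_mapsD(1)[OF f'] linear_mapsD(1)[OF g])
qed

lemma tensor_map_add_right:
  assumes A: "module K A" and B: "module K B" and A': "module K A'" and B': "module K B'"
    and f: "f \<in> linear_maps K A A'"
    and g: "g \<in> linear_maps K B B'" and g': "g' \<in> linear_maps K B B'"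
    and t: "t \<in> carrier (tensor K A B)"
  shows "tensor_map K A' B' f (\<lambda>x. g x \<oplus>\<^bsub>B'\<^esub> g' x) t
    = tensor_map K A' B' f g t \<oplus>\<^bsub>tensor K A' B'\<^esub> tensor_map K A' B' f g' t"
proof -
  note h = linear_maps_add[OF B' g g']
  note l = tensor_map_linear[OF A B A' B' f]
  show ?thesis
    by (rule linear_maps_tensor_eqI[OF A B tensor_module[OF A' B']
          l[OF h] linear_maps_add[OF tensor_module[OF A' B'] l[OF g] l[OF g']] _ t])
      (simp add: tensor_map_pure[OF A B A' B' f] g g' h
        bilinear_mapsD(3)[OF pure_tensor_bilinear[OF A' B']]
        linear_mapsD(1)[OF f] linear_mapsD(1)[OF g] linear_mapsD(1)[OF g'])
qed

lemma tensor_map_smult_left: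
  assumes A: "module K A" and B: "module K B" and A': "module K A'" and B': "module K B'"
    and r: "r \<in> carrier K" and f: "f \<in> linear_maps K A A'" and g: "g \<in> linear_maps K B B'"
    and t: "t \<in> carrier (tensor K A B)"
  shows "tensor_map K A' B' (\<lambda>x. r \<odot>\<^bsub>A'\<^esub> f x) g t
    = r \<odot>\<^bsub>tensor K A' B'\<^esub> tensor_map K A' B' f g t"
proof -
  note h = linear_maps_smult[OF A' f r]
  note l = tensor_map_linear[OF A B A' B' _ g]
  show ?thesis
    by (rule linear_maps_tensor_eqI[OF A B tensor_module[OF A' B']
          l[OF h] linear_maps_smult[OF tensor_module[OF A' B'] l[OF f] r] _ t])
      (simp add: tensor_map_pure[OF A B A' B' _ g] f h r
        bilinear_mapsD(4)[OF pure_tensor_bilinear[OF A' B']]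
        linear_mapsD(1)[OF f] linear_mapsD(1)[OF g])
qed

lemma tensor_map_smult_right:
  assumes A: "module K A" and B: "module K B" and A': "module K A'" and B': "module K B'"
    and r: "r \<in> carrier K" and f: "f \<in> linear_maps K A A'" and g: "g \<in> linear_maps K B B'"
    and t: "t \<in> carrier (tensor K A B)"
  shows "tensor_map K A' B' f (\<lambda>x. r \<odot>\<^bsub>B'\<^esub> g x) t
    = r \<odot>\<^bsub>tensor K A' B'\<^esub> tensor_map K A' B' f g t"
proof -
  note h = linear_maps_smult[OF B' g r]
  note l = tensor_map_linear[OF A B A' B' f]
  show ?thesis
    by (rule linear_maps_tensor_eqI[OF A B tensor_module[OF A' B']
          l[OF h] linear_maps_smult[OF tensor_module[OF A' B'] l[OF g] r] _ t])
      (simp add: tensor_map_pure[OF A B A' B' f] g h r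
        bilinear_mapsD(5)[OF pure_tensor_bilinear[OF A' B']]
        linear_mapsD(1)[OF f] linear_mapsD(1)[OF g])
qed

section \<open>Linearity and naturality of the associativity map\<close>

text \<open>For fixed d the map b \<mapsto> b \<otimes> d is linear, and precomposing the second
  argument of a bilinear map with it keeps bilinearity.\<close>

lemma tensor_assoc_inner_bilinear:
  assumes A: "module K A" and B: "module K B" and D: "module K D" and d: "d \<in> carrier D"
  shows "(\<lambda>a b. pure_tensor K A (tensor K B D) a (pure_tensor K B D b d))
    \<in> bilinear_maps K A B (tensor K A (tensor K B D))"
proof -
  note BD = tensor_module[OF B D]
  have "(\<lambda>b. pure_tensor K B D b d) \<in> linear_maps K B (tensor K B D)"
    using pure_tensor_bilinear[OF B D] d by (simp add: bilinear_maps_def)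
  from bilinear_maps_comp[OF pure_tensor_bilinear[OF A BD] id_linear(1) this]
  show ?thesis .
qed

text \<open>Linearity in t is built into the inner lift. Linearity in d is not visible for a general
  t and is obtained by reducing t to a pure tensor.\<close>

lemma tensor_assoc_outer_bilinear:
  assumes A: "module K A" and B: "module K B" and D: "module K D"
  shows "(\<lambda>t d. tensor_lift K (tensor K A (tensor K B D))
          (\<lambda>a b. pure_tensor K A (tensor K B D) a (pure_tensor K B D b d)) t)
    \<in> bilinear_maps K (tensor K A B) D (tensor K A (tensor K B D))"
proof -
  note BD = tensor_module[OF B D]
  note W = tensor_module[OF A BD]
  interpret D: module K D by fact
  note \<beta> = tensor_assoc_inner_bilinear[OF A B D]
  note l = tensor_lift_linear[OF A B W \<beta>]
  note p = tensor_lift_pure[OF A B W \<beta>]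
  note BD' = bilinear_mapsD[OF pure_tensor_bilinear[OF B D]]
  note ABD' = bilinear_mapsD[OF pure_tensor_bilinear[OF A BD]]
  show ?thesis
    unfolding bilinear_maps_def
  proof (intro CollectI conjI ballI l)
    fix t assume t: "t \<in> carrier (tensor K A B)"
    show "(\<lambda>d. tensor_lift K (tensor K A (tensor K B D))
          (\<lambda>a b. pure_tensor K A (tensor K B D) a (pure_tensor K B D b d)) t)
        \<in> linear_maps K D (tensor K A (tensor K B D))"
      unfolding linear_maps_def
    proof (intro CollectI conjI ballI funcsetI)
      fix d assume d: "d \<in> carrier D"
      show "tensor_lift K (tensor K A (tensor K B D))
          (\<lambda>a b. pure_tensor K A (tensor K B D) a (pure_tensor K B D b d)) t
          \<in> carrier (tensor K A (tensor K B D))"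
        by (rule linear_mapsD(1)[OF l[OF d] t])
      fix d' assume d': "d' \<in> carrier D"
      have dd: "d \<oplus>\<^bsub>D\<^esub> d' \<in> carrier D" using d d' by simp
      show "tensor_lift K (tensor K A (tensor K B D))
          (\<lambda>a b. pure_tensor K A (tensor K B D) a (pure_tensor K B D b (d \<oplus>\<^bsub>D\<^esub> d'))) t
        = tensor_lift K (tensor K A (tensor K B D))
          (\<lambda>a b. pure_tensor K A (tensor K B D) a (pure_tensor K B D b d)) t
          \<oplus>\<^bsub>tensor K A (tensor K B D)\<^esub> tensor_lift K (tensor K A (tensor K B D))
          (\<lambda>a b. pure_tensor K A (tensor K B D) a (pure_tensor K B D b d')) t"
        \<comment> \<open>With d and d' fixed, both sides are linear in t; on a \<otimes> b the
          claim is additivity of the pure tensor a \<otimes> (b \<otimes> d) in d.\<close>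
        by (rule linear_maps_tensor_eqI[OF A B W l[OF dd] linear_maps_add[OF W l[OF d] l[OF d']] _ t])
          (simp add: p d d' dd BD' ABD')
    next
      fix r d assume r: "r \<in> carrier K" and d: "d \<in> carrier D"
      have rd: "r \<odot>\<^bsub>D\<^esub> d \<in> carrier D" using r d by simp
      show "tensor_lift K (tensor K A (tensor K B D))
          (\<lambda>a b. pure_tensor K A (tensor K B D) a (pure_tensor K B D b (r \<odot>\<^bsub>D\<^esub> d))) t
        = r \<odot>\<^bsub>tensor K A (tensor K B D)\<^esub> tensor_lift K (tensor K A (tensor K B D))
          (\<lambda>a b. pure_tensor K A (tensor K B D) a (pure_tensor K B D b d)) t"
        by (rule linear_maps_tensor_eqI[OF A B W l[OF rd] linear_maps_smult[OF W l[OF d] r] _ t])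
          (simp add: p d r rd BD' ABD')
    qed
  qed
qed

lemma tensor_assoc_linear:
  assumes A: "module K A" and B: "module K B" and D: "module K D"
  shows "tensor_assoc K A B D
    \<in> linear_maps K (tensor K (tensor K A B) D) (tensor K A (tensor K B D))"
  unfolding tensor_assoc_def
  by (intro tensor_lift_linear tensor_module tensor_assoc_outer_bilinear assms)

lemma tensor_assoc_pure:
  assumes A: "module K A" and B: "module K B" and D: "module K D"
    and a: "a \<in> carrier A" and b: "b \<in> carrier B" and d: "d \<in> carrier D"
  shows "tensor_assoc K A B D (pure_tensor K (tensor K A B) D (pure_tensor K A B a b) d)
    = pure_tensor K A (tensor K B D) a (pure_tensor K B D b d)"
proof -
  note W = tensor_module[OF A tensor_module[OF B D]]
  show ?thesis
    unfolding tensor_assoc_def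
      tensor_lift_pure[OF tensor_module[OF A B] D W tensor_assoc_outer_bilinear[OF A B D]
        pure_tensor_closed[OF A B a b] d]
    by (rule tensor_lift_pure[OF A B W tensor_assoc_inner_bilinear[OF A B D d] a b])
qed

text \<open>The generation argument is applied twice: first to the outer product, then, with d
  fixed, to the inner one.\<close>

lemma linear_maps_tensor3_eqI:
  assumes A: "module K A" and B: "module K B" and D: "module K D" and W: "module K W"
    and f: "f \<in> linear_maps K (tensor K (tensor K A B) D) W"
    and g: "g \<in> linear_maps K (tensor K (tensor K A B) D) W"
    and eq: "\<And>a b d. \<lbrakk>a \<in> carrier A; b \<in> carrier B; d \<in> carrier D\<rbrakk>
      \<Longrightarrow> f (pure_tensor K (tensor K A B) D (pure_tensor K A B a b) d)
        = g (pure_tensor K (tensor K A B) D (pure_tensor K A B a b) d)"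
    and t: "t \<in> carrier (tensor K (tensor K A B) D)"
  shows "f t = g t"
proof (rule linear_maps_tensor_eqI[OF tensor_module[OF A B] D W f g _ t])
  fix s d assume s: "s \<in> carrier (tensor K A B)" and d: "d \<in> carrier D"
  \<comment> \<open>Composing with this linear map turns f and g into linear maps of s
    alone.\<close>
  have p: "(\<lambda>s. pure_tensor K (tensor K A B) D s d)
      \<in> linear_maps K (tensor K A B) (tensor K (tensor K A B) D)"
    using pure_tensor_bilinear[OF tensor_module[OF A B] D] d by (simp add: bilinear_maps_def)
  show "f (pure_tensor K (tensor K A B) D s d) = g (pure_tensor K (tensor K A B) D s d)"
    by (rule linear_maps_tensor_eqI[OF A B W linear_maps_comp[OF f p] linear_maps_comp[OF g p]
          _ s]) (rule eq[OF _ _ d])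
qed

text \<open>Both sides send (a \<otimes> b) \<otimes> d to f a \<otimes> (g b \<otimes> h d). This
  is what allows the terms on the two sides of coassociativity to be matched one by one.\<close>

lemma tensor_assoc_natural:
  assumes A: "module K A" and B: "module K B" and D: "module K D"
    and A': "module K A'" and B': "module K B'" and D': "module K D'"
    and f: "f \<in> linear_maps K A A'" and g: "g \<in> linear_maps K B B'" and h: "h \<in> linear_maps K D D'"
    and t: "t \<in> carrier (tensor K (tensor K A B) D)"
  shows "tensor_assoc K A' B' D' (tensor_map K (tensor K A' B') D' (tensor_map K A' B' f g) h t)
    = tensor_map K A' (tensor K B' D') f (tensor_map K B' D' g h) (tensor_assoc K A B D t)"
proof -
  note AB = tensor_module[OF A B] and BD = tensor_module[OF B D]
  note AB' = tensor_module[OF A' B'] and BD' = tensor_module[OF B' D']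
  note fg = tensor_map_linear[OF A B A' B' f g] and gh = tensor_map_linear[OF B D B' D' g h]
  note fg_h = tensor_map_linear[OF AB D AB' D' fg h] and f_gh = tensor_map_linear[OF A BD A' BD' f gh]
  note c = linear_mapsD(1)[OF f] linear_mapsD(1)[OF g] linear_mapsD(1)[OF h]
    pure_tensor_closed[OF A B] pure_tensor_closed[OF B D]
  show ?thesis
    by (rule linear_maps_tensor3_eqI[OF A B D tensor_module[OF A' BD']
          linear_maps_comp[OF tensor_assoc_linear[OF A' B' D'] fg_h]
          linear_maps_comp[OF f_gh tensor_assoc_linear[OF A B D]] _ t])
      (simp add: c tensor_map_pure[OF AB D AB' D' fg h] tensor_map_pure[OF A BD A' BD' f gh]
        tensor_map_pure[OF A B A' B' f g] tensor_map_pure[OF B D B' D' g h]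
        tensor_assoc_pure[OF A B D] tensor_assoc_pure[OF A' B' D'])
qed

section \<open>The derived coaction\<close>

context noncounitary_rota_baxter_paired_comodule
begin

abbreviation CM where "CM \<equiv> tensor K C M"
abbreviation \<rho>' where "\<rho>' \<equiv> derived_coact K w C M \<rho> P T"

lemma tensor_module_CM: "module K CM"
  by (rule tensor_module[OF C.module_axioms M.module_axioms])

lemmas tensor_map_CM_linear =
  tensor_map_linear[OF C.module_axioms M.module_axioms C.module_axioms M.module_axioms]

lemmas tensor_map_CM_comp =
  tensor_map_comp[OF C.module_axioms M.module_axioms C.module_axioms M.module_axioms
    C.module_axioms M.module_axioms]

lemma coact_closed: "m \<in> carrier M \<Longrightarrow> \<rho> m \<in> carrier CM"
  by (rule linear_mapsD(1)[OF coact_linear])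

lemma derived_coact_linear: "\<rho>' \<in> linear_maps K M CM"
  unfolding derived_coact_def
  by (intro linear_maps_add linear_maps_smult linear_maps_comp[OF tensor_map_CM_linear coact_linear]
      tensor_module_CM coact_linear P_linear T_linear id_linear weight_closed)

lemma derived_coact_T: "m \<in> carrier M \<Longrightarrow> \<rho>' (T m) = tensor_map K C M P T (\<rho> m)"
  by (simp add: derived_coact_def rota_baxter_paired)

text \<open>Stated for an arbitrary linear \<open>h\<close> because it serves for P \<otimes> T, for
  id \<otimes> \<rho>' and for \<Delta>' \<otimes> id.\<close>

lemma linear_derived_coact:
  assumes W: "module K W" and h: "h \<in> linear_maps K CM W" and m: "m \<in> carrier M"
  shows "h (\<rho>' m) = h (tensor_map K C M P id (\<rho> m))
    \<oplus>\<^bsub>W\<^esub> h (tensor_map K C M id T (\<rho> m)) \<oplus>\<^bsub>W\<^esub> w \<odot>\<^bsub>W\<^esub> h (\<rho> m)"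
proof -
  interpret CM: module K CM by (rule tensor_module_CM)
  note c = coact_closed[OF m] linear_mapsD(1)[OF tensor_map_CM_linear[OF P_linear id_linear(2)]]
    linear_mapsD(1)[OF tensor_map_CM_linear[OF id_linear(2) T_linear]]
  show ?thesis
    unfolding derived_coact_def
    by (simp add: linear_mapsD[OF h] c weight_closed)
qed

text \<open>P \<otimes> T commutes with P \<otimes> id and with id \<otimes> T. Since \<rho>' T = (P
  \<otimes> T) \<rho>, the three summands on the two sides agree in order.\<close>

lemma derived_rota_baxter_paired:
  assumes m: "m \<in> carrier M"
  shows "tensor_map K C M P T (\<rho>' m)
      = tensor_map K C M P id (\<rho>' (T m)) \<oplus>\<^bsub>CM\<^esub> tensor_map K C M id T (\<rho>' (T m))
        \<oplus>\<^bsub>CM\<^esub> w \<odot>\<^bsub>CM\<^esub> \<rho>' (T m)"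
  unfolding linear_derived_coact[OF tensor_module_CM tensor_map_CM_linear[OF P_linear T_linear] m]
    derived_coact_T[OF m]
  using coact_closed[OF m]
  by (simp add: tensor_map_CM_comp P_linear T_linear id_linear)

text \<open>The second factor is additive, and each summand f \<otimes> (h \<rho>) splits as (f
  \<otimes> h)(id \<otimes> \<rho>), so everything is expressed through the single tensor
  \<open>s\<close>.\<close>

lemma tensor_map_derived_coact:
  assumes f: "f \<in> linear_maps K C C" and t: "t \<in> carrier CM"
  defines "s \<equiv> tensor_map K C CM id \<rho> t"
  shows "tensor_map K C CM f \<rho>' t = tensor_map K C CM f (tensor_map K C M P id) s
    \<oplus>\<^bsub>tensor K C CM\<^esub> tensor_map K C CM f (tensor_map K C M id T) s
    \<oplus>\<^bsub>tensor K C CM\<^esub> w \<odot>\<^bsub>tensor K C CM\<^esub> tensor_map K C CM f id s"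
proof -
  note mods = C.module_axioms M.module_axioms C.module_axioms tensor_module_CM
  note h = tensor_map_CM_linear[OF P_linear id_linear(2)] tensor_map_CM_linear[OF id_linear(2) T_linear]
  note hr = linear_maps_comp[OF h(1) coact_linear] linear_maps_comp[OF h(2) coact_linear]
  note c = tensor_map_comp[OF mods C.module_axioms tensor_module_CM id_linear(2) coact_linear f _ t, simplified]
  have "tensor_map K C CM f \<rho>' t
      = tensor_map K C CM f (\<lambda>x. tensor_map K C M P id (\<rho> x)) t
      \<oplus>\<^bsub>tensor K C CM\<^esub> tensor_map K C CM f (\<lambda>x. tensor_map K C M id T (\<rho> x)) t
      \<oplus>\<^bsub>tensor K C CM\<^esub> w \<odot>\<^bsub>tensor K C CM\<^esub> tensor_map K C CM f \<rho> t"
    unfolding derived_coact_def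
      tensor_map_add_right[OF mods f linear_maps_add[OF tensor_module_CM hr]
        linear_maps_smult[OF tensor_module_CM coact_linear weight_closed] t]
      tensor_map_add_right[OF mods f hr t]
      tensor_map_smult_right[OF mods weight_closed f coact_linear t] ..
  then show ?thesis
    unfolding s_def c[OF h(1)] c[OF h(2)] c[OF id_linear(2), simplified] .
qed

lemma tensor_map_derived_coact_T:
  assumes t: "t \<in> carrier CM"
  shows "tensor_map K C CM id \<rho>' (tensor_map K C M id T t)
    = tensor_map K C CM id (tensor_map K C M P T) (tensor_map K C CM id \<rho> t)"
proof -
  note mods = C.module_axioms M.module_axioms C.module_axioms
  note PT = tensor_map_CM_linear[OF P_linear T_linear]
  have "tensor_map K C CM id \<rho>' (tensor_map K C M id T t)
      = tensor_map K C CM (\<lambda>x. id (id x)) (\<lambda>x. \<rho>' (T x)) t"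
    by (rule tensor_map_comp[OF mods M.module_axioms C.module_axioms tensor_module_CM
          id_linear(2) T_linear id_linear(2) derived_coact_linear t])
  \<comment> \<open>The identity \<rho>' T = (P \<otimes> T) \<rho> enters here; it holds on the
    carrier of M, hence the congruence rule.\<close>
  also have "\<dots> = tensor_map K C CM (\<lambda>x. id (id x)) (\<lambda>x. tensor_map K C M P T (\<rho> x)) t"
    by (rule tensor_map_cong[OF mods tensor_module_CM linear_maps_comp[OF id_linear(2) id_linear(2)]
          linear_maps_comp[OF derived_coact_linear T_linear] refl derived_coact_T t])
  also have "\<dots> = tensor_map K C CM id (tensor_map K C M P T) (tensor_map K C CM id \<rho> t)"
    by (rule tensor_map_comp[OF mods tensor_module_CM C.module_axioms tensor_module_CM
          id_linear(2) coact_linear id_linear(2) PT t, symmetric])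
  finally show ?thesis .
qed

text \<open>The three groups of summands come from the summands P \<otimes> id, id \<otimes> T and w
  of the inner \<rho>', in this order; the middle one is a single term by the previous
  lemma.\<close>

lemma derived_coact_iterate:
  assumes m: "m \<in> carrier M"
  defines "s \<equiv> tensor_map K C CM id \<rho> (\<rho> m)"
    and "E \<equiv> \<lambda>f g h. tensor_map K C CM f (tensor_map K C M g h)"
  shows "tensor_map K C CM id \<rho>' (\<rho>' m) =
    (E P P id s \<oplus>\<^bsub>tensor K C CM\<^esub> E P id T s \<oplus>\<^bsub>tensor K C CM\<^esub> w \<odot>\<^bsub>tensor K C CM\<^esub> E P id id s)
    \<oplus>\<^bsub>tensor K C CM\<^esub> E id P T s
    \<oplus>\<^bsub>tensor K C CM\<^esub> w \<odot>\<^bsub>tensor K C CM\<^esub>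
      (E id P id s \<oplus>\<^bsub>tensor K C CM\<^esub> E id id T s \<oplus>\<^bsub>tensor K C CM\<^esub> w \<odot>\<^bsub>tensor K C CM\<^esub> E id id id s)"
proof -
  note mods = C.module_axioms M.module_axioms C.module_axioms
  note t = coact_closed[OF m]
  have X: "module K (tensor K C CM)" by (rule tensor_module[OF C.module_axioms tensor_module_CM])
  have F: "tensor_map K C CM id \<rho>' \<in> linear_maps K CM (tensor K C CM)"
    by (rule tensor_map_linear[OF mods tensor_module_CM id_linear(2) derived_coact_linear])
  have s: "s \<in> carrier (tensor K C CM)"
    unfolding s_def
    by (rule linear_mapsD(1)[OF tensor_map_linear[OF mods tensor_module_CM id_linear(2) coact_linear] t])
  \<comment> \<open>P acts on the first factor and \<rho>' on the second, so the composite is P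
    \<otimes> \<rho>'.\<close>
  have P: "tensor_map K C CM id \<rho>' (tensor_map K C M P id (\<rho> m)) = tensor_map K C CM P \<rho>' (\<rho> m)"
    using tensor_map_comp[OF mods M.module_axioms C.module_axioms tensor_module_CM
        P_linear id_linear(2) id_linear(2) derived_coact_linear t]
    by simp
  \<comment> \<open>The identity of C \<otimes> M agrees with id \<otimes> id on the carrier; this
    brings the remaining terms into the shape of \<open>E\<close>.\<close>
  have i: "tensor_map K C CM f id s = E f id id s" if f: "f \<in> linear_maps K C C" for f
    unfolding E_def
    by (rule tensor_map_cong[OF C.module_axioms tensor_module_CM C.module_axioms tensor_module_CM
          f id_linear(2) refl _ s])
      (use tensor_map_ident[OF C.module_axioms M.module_axioms] in \<open>simp add: id_def\<close>)
  show ?thesis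
    unfolding linear_derived_coact[OF X F m] P tensor_map_derived_coact[OF P_linear t]
      tensor_map_derived_coact[OF id_linear(2) t] tensor_map_derived_coact_T[OF t]
      s_def[symmetric] i[OF P_linear] i[OF id_linear(2)]
    unfolding E_def ..
qed

end

section \<open>The coalgebra as a paired comodule over itself\<close>

context noncounitary_rota_baxter_coalgebra
begin

lemma paired_self: "noncounitary_rota_baxter_paired_comodule K w C \<Delta> C \<Delta> P P"
  by unfold_locales (use comult_linear coassoc weight_closed P_linear rota_baxter in auto)

sublocale self: noncounitary_rota_baxter_paired_comodule K w C \<Delta> C \<Delta> P P
  by (rule paired_self)

text \<open>The two definitions list P \<otimes> id and id \<otimes> P in opposite orders, so they
  agree by commutativity of addition, which is available on the carrier.\<close>

lemma derived_comult_eq_coact: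
  assumes c: "c \<in> carrier C"
  shows "derived_coact K w C C \<Delta> P P c = derived_comult K w C \<Delta> P c"
proof -
  interpret CC: module K "tensor K C C" by (rule self.tensor_module_CM)
  note cl = linear_mapsD(1)[OF self.tensor_map_CM_linear self.coact_closed[OF c]]
  show ?thesis
    using cl[OF P_linear id_linear(2)] cl[OF id_linear(2) P_linear]
    by (simp add: derived_coact_def derived_comult_def CC.M.a_comm)
qed

lemma derived_comult_linear: "derived_comult K w C \<Delta> P \<in> linear_maps K C (tensor K C C)"
  by (rule linear_maps_cong[OF C.module_axioms self.derived_coact_linear derived_comult_eq_coact])

lemma derived_comult_P:
  assumes "c \<in> carrier C"
  shows "derived_comult K w C \<Delta> P (P c) = tensor_map K C C P P (\<Delta> c)"
  using self.derived_coact_T[OF assms] derived_comult_eq_coact[OF linear_mapsD(1)[OF P_linear assms]]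
  by simp

end

section \<open>Coassociativity of the derived coaction\<close>

text \<open>Here P is a Rota-Baxter operator on C as well, which gives \<Delta>' P = (P \<otimes> P)
  \<Delta>. The setting covers both the given M and the case M = C.\<close>

locale noncounitary_rota_baxter_pair =
  noncounitary_rota_baxter_coalgebra K w C \<Delta> P
  + paired: noncounitary_rota_baxter_paired_comodule K w C \<Delta> M \<rho> P T
  for K :: "('k, 'm) ring_scheme" and w :: 'k
    and C :: "('k, 'c, 'p) module_scheme" and \<Delta>
    and M :: "('k, 'a, 'q) module_scheme" and \<rho> P T
begin

abbreviation CC where "CC \<equiv> tensor K C C"
abbreviation CM where "CM \<equiv> tensor K C M"
abbreviation \<Delta>' where "\<Delta>' \<equiv> derived_comult K w C \<Delta> P"
abbreviation \<rho>' where "\<rho>' \<equiv> derived_coact K w C M \<rho> P T"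

text \<open>Mirror image of the expansion of f \<otimes> \<rho>': the first factor is now split, and
  all terms are expressed through (\<Delta> \<otimes> id) t.\<close>

lemma tensor_map_derived_comult:
  assumes h: "h \<in> linear_maps K M M" and t: "t \<in> carrier CM"
  defines "u \<equiv> tensor_map K CC M \<Delta> id t"
  shows "tensor_map K CC M \<Delta>' h t = tensor_map K CC M (tensor_map K C C id P) h u
    \<oplus>\<^bsub>tensor K CC M\<^esub> tensor_map K CC M (tensor_map K C C P id) h u
    \<oplus>\<^bsub>tensor K CC M\<^esub> w \<odot>\<^bsub>tensor K CC M\<^esub> tensor_map K CC M id h u"
proof -
  note CC = self.tensor_module_CM
  note mods = C.module_axioms paired.M.module_axioms CC paired.M.module_axioms
  note g = self.tensor_map_CM_linear[OF id_linear(2) P_linear]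
    self.tensor_map_CM_linear[OF P_linear id_linear(2)]
  note gr = linear_maps_comp[OF g(1) comult_linear] linear_maps_comp[OF g(2) comult_linear]
  note c = tensor_map_comp[OF mods CC paired.M.module_axioms comult_linear id_linear(2) _ h t, simplified]
  have "tensor_map K CC M \<Delta>' h t
      = tensor_map K CC M (\<lambda>x. tensor_map K C C id P (\<Delta> x)) h t
      \<oplus>\<^bsub>tensor K CC M\<^esub> tensor_map K CC M (\<lambda>x. tensor_map K C C P id (\<Delta> x)) h t
      \<oplus>\<^bsub>tensor K CC M\<^esub> w \<odot>\<^bsub>tensor K CC M\<^esub> tensor_map K CC M \<Delta> h t"
    unfolding derived_comult_def
      tensor_map_add_left[OF mods linear_maps_add[OF CC gr]
        linear_maps_smult[OF CC comult_linear weight_closed] h t]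
      tensor_map_add_left[OF mods gr h t]
      tensor_map_smult_left[OF mods weight_closed comult_linear h t] ..
  then show ?thesis
    unfolding u_def c[OF g(1)] c[OF g(2)] c[OF id_linear(2), simplified] .
qed

lemma tensor_map_derived_comult_P:
  assumes t: "t \<in> carrier CM"
  shows "tensor_map K CC M \<Delta>' id (tensor_map K C M P id t)
    = tensor_map K CC M (tensor_map K C C P P) id (tensor_map K CC M \<Delta> id t)"
proof -
  note CC = self.tensor_module_CM
  note M = paired.M.module_axioms
  note PP = self.tensor_map_CM_linear[OF P_linear P_linear]
  have "tensor_map K CC M \<Delta>' id (tensor_map K C M P id t)
      = tensor_map K CC M (\<lambda>x. \<Delta>' (P x)) (\<lambda>x. id (id x)) t"
    by (rule tensor_map_comp[OF C.module_axioms M C.module_axioms M CC M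
          P_linear id_linear(2) derived_comult_linear id_linear(2) t])
  also have "\<dots> = tensor_map K CC M (\<lambda>x. tensor_map K C C P P (\<Delta> x)) (\<lambda>x. id (id x)) t"
    by (rule tensor_map_cong[OF C.module_axioms M CC M
          linear_maps_comp[OF derived_comult_linear P_linear]
          linear_maps_comp[OF id_linear(2) id_linear(2)] derived_comult_P refl t])
  also have "\<dots> = tensor_map K CC M (tensor_map K C C P P) id (tensor_map K CC M \<Delta> id t)"
    by (rule tensor_map_comp[OF C.module_axioms M CC M CC M
          comult_linear id_linear(2) PP id_linear(2) t, symmetric])
  finally show ?thesis .
qed

text \<open>The groups again follow the summands of \<rho>'. This time P \<otimes> id gives the
  single term, by \<Delta>' P = (P \<otimes> P) \<Delta>, and id \<otimes> T gives three.\<close>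

lemma derived_comult_iterate:
  assumes m: "m \<in> carrier M"
  defines "u \<equiv> tensor_map K CC M \<Delta> id (\<rho> m)"
    and "E \<equiv> \<lambda>f g h. tensor_map K CC M (tensor_map K C C f g) h"
  shows "tensor_map K CC M \<Delta>' id (\<rho>' m) =
    E P P id u
    \<oplus>\<^bsub>tensor K CC M\<^esub> (E id P T u \<oplus>\<^bsub>tensor K CC M\<^esub> E P id T u
      \<oplus>\<^bsub>tensor K CC M\<^esub> w \<odot>\<^bsub>tensor K CC M\<^esub> E id id T u)
    \<oplus>\<^bsub>tensor K CC M\<^esub> w \<odot>\<^bsub>tensor K CC M\<^esub>
      (E id P id u \<oplus>\<^bsub>tensor K CC M\<^esub> E P id id u \<oplus>\<^bsub>tensor K CC M\<^esub> w \<odot>\<^bsub>tensor K CC M\<^esub> E id id id u)"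
proof -
  note CC = self.tensor_module_CM
  note M = paired.M.module_axioms
  note t = paired.coact_closed[OF m]
  have Y: "module K (tensor K CC M)" by (rule tensor_module[OF CC M])
  have G: "tensor_map K CC M \<Delta>' id \<in> linear_maps K CM (tensor K CC M)"
    by (rule tensor_map_linear[OF C.module_axioms M CC M derived_comult_linear id_linear(2)])
  have u: "u \<in> carrier (tensor K CC M)"
    unfolding u_def
    by (rule linear_mapsD(1)[OF tensor_map_linear[OF C.module_axioms M CC M comult_linear id_linear(2)] t])
  have T: "tensor_map K CC M \<Delta>' id (tensor_map K C M id T (\<rho> m)) = tensor_map K CC M \<Delta>' T (\<rho> m)"
    using tensor_map_comp[OF C.module_axioms M C.module_axioms M CC M
        id_linear(2) paired.T_linear derived_comult_linear id_linear(2) t]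
    by simp
  have i: "tensor_map K CC M id h u = E id id h u" if h: "h \<in> linear_maps K M M" for h
    unfolding E_def
    by (rule tensor_map_cong[OF CC M CC M id_linear(2) h _ refl u])
      (use tensor_map_ident[OF C.module_axioms C.module_axioms] in \<open>simp add: id_def\<close>)
  show ?thesis
    unfolding paired.linear_derived_coact[OF Y G m] T tensor_map_derived_comult[OF paired.T_linear t]
      tensor_map_derived_comult[OF id_linear(2) t] tensor_map_derived_comult_P[OF t]
      u_def[symmetric] i[OF paired.T_linear] i[OF id_linear(2)]
    unfolding E_def ..
qed


text \<open>Coassociativity of \<rho> says that the associativity map sends \<open>?u\<close> to
  \<open>?s\<close>. By naturality it then sends each \<open>?E f g h\<close> to
  \<open>?D f g h\<close>, and the two seven-term expansions contain the same terms.\<close>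

lemma derived_coact_coassoc:
  assumes m: "m \<in> carrier M"
  shows "tensor_map K C CM id \<rho>' (\<rho>' m)
    = tensor_assoc K C C M (tensor_map K CC M \<Delta>' id (\<rho>' m))"
proof -
  note CC = self.tensor_module_CM and CM = paired.tensor_module_CM
  note C = C.module_axioms and M = paired.M.module_axioms
  note t = paired.coact_closed[OF m]
  let ?s = "tensor_map K C CM id \<rho> (\<rho> m)" and ?u = "tensor_map K CC M \<Delta> id (\<rho> m)"
  let ?E = "\<lambda>f g h. tensor_map K CC M (tensor_map K C C f g) h ?u"
  let ?D = "\<lambda>f g h. tensor_map K C CM f (tensor_map K C M g h) ?s"
  interpret X: module K "tensor K C CM" by (rule tensor_module[OF C CM])
  interpret Y: module K "tensor K CC M" by (rule tensor_module[OF CC M])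
  have s: "?s \<in> carrier (tensor K C CM)"
    by (rule linear_mapsD(1)[OF tensor_map_linear[OF C M C CM id_linear(2) paired.coact_linear] t])
  have u: "?u \<in> carrier (tensor K CC M)"
    by (rule linear_mapsD(1)[OF tensor_map_linear[OF C M CC M comult_linear id_linear(2)] t])
  have E: "?E f g h \<in> carrier (tensor K CC M)"
    and D: "?D f g h \<in> carrier (tensor K C CM)"
    and ED: "tensor_assoc K C C M (?E f g h) = ?D f g h"
    if f: "f \<in> linear_maps K C C" and g: "g \<in> linear_maps K C C" and h: "h \<in> linear_maps K M M"
    for f g h
  proof -
    show "?E f g h \<in> carrier (tensor K CC M)"
      by (rule linear_mapsD(1)[OF tensor_map_linear[OF CC M CC M self.tensor_map_CM_linear[OF f g] h] u])
    show "?D f g h \<in> carrier (tensor K C CM)"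
      by (rule linear_mapsD(1)[OF tensor_map_linear[OF C CM C CM f paired.tensor_map_CM_linear[OF g h]] s])
    show "tensor_assoc K C C M (?E f g h) = ?D f g h"
      unfolding tensor_assoc_natural[OF C C M C C M f g h u] paired.coact_coassoc[OF m] ..
  qed
  note l = P_linear paired.T_linear id_linear(2) weight_closed
  show ?thesis
    unfolding paired.derived_coact_iterate[OF m] derived_comult_iterate[OF m]
    \<comment> \<open>First the associativity map is moved through sums and multiples. Then the
      terms are reordered after distributing w, since w P.id.id and w id.id.T sit in different
      groups on the two sides.\<close>
    by (simp add: linear_mapsD(2,3)[OF tensor_assoc_linear[OF C C M]] E ED l)
      (simp add: D l X.smult_r_distr X.M.a_ac)
qed

end

section \<open>The derived coalgebra and comodule structures\<close>

lemma (in noncounitary_rota_baxter_coalgebra) derived_rota_baxter_coalgebra: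
  "noncounitary_rota_baxter_coalgebra K w C (derived_comult K w C \<Delta> P) P"
proof -
  interpret pair: noncounitary_rota_baxter_pair K w C \<Delta> C \<Delta> P P
    by unfold_locales
  show ?thesis
  proof unfold_locales
    fix c assume c: "c \<in> carrier C"
    have Pc: "P c \<in> carrier C" by (rule linear_mapsD(1)[OF P_linear c])
    show "tensor_map K C (tensor K C C) id (derived_comult K w C \<Delta> P) (derived_comult K w C \<Delta> P c)
      = tensor_assoc K C C C (tensor_map K (tensor K C C) C (derived_comult K w C \<Delta> P) id
          (derived_comult K w C \<Delta> P c))"
      \<comment> \<open>For M = C this yields coassociativity with \<open>derived_coact\<close>
        inside id \<otimes> \<rho>'; the congruence rule replaces it there by
        \<open>derived_comult\<close>, with which it agrees on the carrier.\<close>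
      using pair.derived_coact_coassoc[OF c]
        tensor_map_cong[where f' = id, OF C.module_axioms C.module_axioms C.module_axioms
          self.tensor_module_CM id_linear(2) self.derived_coact_linear refl derived_comult_eq_coact
          linear_mapsD(1)[OF derived_comult_linear c]]
      by (simp add: derived_comult_eq_coact[OF c])
    show "tensor_map K C C P P (derived_comult K w C \<Delta> P c)
      = tensor_map K C C P id (derived_comult K w C \<Delta> P (P c))
        \<oplus>\<^bsub>tensor K C C\<^esub> tensor_map K C C id P (derived_comult K w C \<Delta> P (P c))
        \<oplus>\<^bsub>tensor K C C\<^esub> w \<odot>\<^bsub>tensor K C C\<^esub> derived_comult K w C \<Delta> P (P c)"
      using self.derived_rota_baxter_paired[OF c] by (simp add: derived_comult_eq_coact c Pc)
  qed (rule derived_comult_linear weight_closed P_linear)+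
qed

lemma (in noncounitary_rota_baxter_pair) derived_comodule: "noncounitary_comodule K C \<Delta>' M \<rho>'"
proof -
  \<comment> \<open>A comodule over (C, \<Delta>') presupposes that \<Delta>' is coassociative, so
    the coalgebra statement comes first.\<close>
  interpret D: noncounitary_rota_baxter_coalgebra K w C "\<Delta>'" P
    by (rule derived_rota_baxter_coalgebra)
  show ?thesis
    by unfold_locales (rule paired.derived_coact_linear, rule derived_coact_coassoc)
qed

lemma (in noncounitary_rota_baxter_pair) derived_paired_comodule:
  "noncounitary_rota_baxter_paired_comodule K w C \<Delta>' M \<rho>' P T"
proof -
  interpret D: noncounitary_comodule K C "\<Delta>'" M "\<rho>'"
    by (rule derived_comodule)
  show ?thesis
    by unfold_locales
      (rule weight_closed P_linear paired.T_linear paired.derived_rota_baxter_paired)+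
qed

theorem proposition4p16:
  fixes K :: "('k, 'm) ring_scheme" and w :: 'k
    and C :: "('k, 'c, 'p) module_scheme" and \<Delta> :: "'c \<Rightarrow> ('c \<times> 'c \<Rightarrow> 'k) set"
    and \<epsilon> :: "'c \<Rightarrow> 'k" and P :: "'c \<Rightarrow> 'c"
    and M :: "('k, 'a, 'q) module_scheme" and \<rho> :: "'a \<Rightarrow> ('c \<times> 'a \<Rightarrow> 'k) set"
    and T :: "'a \<Rightarrow> 'a"
  assumes "field K" and "w \<in> carrier K"
    and "rota_baxter_coalgebra K w C \<Delta> \<epsilon> P"
    and "rota_baxter_paired_comodule K w C \<Delta> \<epsilon> M \<rho> P T"
  shows "noncounitary_rota_baxter_coalgebra K w C (derived_comult K w C \<Delta> P) P
    \<and> (\<forall>m\<in>carrier M. derived_coact K w C M \<rho> P T (T m) = tensor_map K C M P T (\<rho> m))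
    \<and> noncounitary_comodule K C (derived_comult K w C \<Delta> P) M (derived_coact K w C M \<rho> P T)
    \<and> noncounitary_rota_baxter_paired_comodule K w C (derived_comult K w C \<Delta> P)
           M (derived_coact K w C M \<rho> P T) P T"
proof -
  interpret C: rota_baxter_coalgebra K w C \<Delta> \<epsilon> P by fact
  interpret M: rota_baxter_paired_comodule K w C \<Delta> \<epsilon> M \<rho> P T by fact
  interpret noncounitary_rota_baxter_pair K w C \<Delta> M \<rho> P T by unfold_locales
  show ?thesis
    using C.derived_rota_baxter_coalgebra derived_comodule derived_paired_comodule M.derived_coact_T
    by blast
qed

end
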